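(* Let $f,g,h,R$ satisfy the standing assumptions on the data listed in the context, let $v^*$ be the optimal value function, let $\Omega\subset\mathbb{R}^{N}$ be a domain containing the origin, and suppose $v^*\in C^1(\Omega,\mathbb{R})$. Let $\alpha,\beta>0$. Then there exists an open neighborhood of the origin $\tilde\Omega\subset\Omega$, depending only on $\Omega$, $\alpha$, $\beta$ and $v^*$ (in particular, one and the same set $\tilde\Omega$ for all candidates $v$), such that every $v\in C^{1}(\Omega,\mathbb{R})$ satisfying (1) $v(x)\ge 0$ for all $x\in\Omega$ and $v(0)=0$; (2) $\bigl\langle f(x)+g(x)u_{v}(x),\nabla v(x)\bigr\rangle + h(x) + \|u_{v}(x)\|_{R}^2 = 0$ for all $x\in\Omega$, where $u_{v}(x) := -\tfrac12\,R^{-1} g(x)^{\top}\nabla v(x)$; (3) $\alpha\|x\|^2\le v(x)\le\beta\|x\|^2$ for all $x\in\Omega$ fulfills $v(x)=v^*(x)$ for all $x\in\tilde\Omega$.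
   Context: Let $N,M\in\mathbb{N}$. $\langle\cdot,\cdot\rangle$ is the Euclidean inner product, $\|\cdot\|$ the Euclidean norm, and $\|y\|_A:=\sqrt{\langle y,Ay\rangle}$ for symmetric positive definite $A$. A domain is a nonempty, open, connected subset of $\mathbb{R}^N$. Standing assumptions on the data: $f\in C^1(\mathbb{R}^N,\mathbb{R}^N)$, $g\in C^1(\mathbb{R}^N,\mathbb{R}^{N\times M})$, $h\in C^1(\mathbb{R}^N,\mathbb{R})$, $R\in\mathbb{R}^{M\times M}$ is symmetric positive definite, $f(0)=0$, $h(0)=0$ and $h(x)>0$ for all $x\ne0$. Optimal control problem: let $\mathcal{U}_\infty:=L^\infty([0,\infty);\mathbb{R}^M)$. For $x\in\mathbb{R}^N$ and $\mathbf{u}\in\mathcal{U}_\infty$ let $\mathbf{x}_{\mathbf{u}}(\cdot;x)$ be the unique maximal Carathéodory solution of $\dot{\mathbf{x}}_{\mathbf{u}}(t;x)=f(\mathbf{x}_{\mathbf{u}}(t;x))+g(\mathbf{x}_{\mathbf{u}}(t;x))\mathbf{u}(t)$, $\mathbf{x}_{\mathbf{u}}(0;x)=x$. Put $$J_\infty(x,\mathbf{u}):=\int_0^\infty h(\mathbf{x}_{\mathbf{u}}(t;x))+\langle\mathbf{u}(t),R\mathbf{u}(t)\rangle\,dt,$$ with $J_\infty(x,\mathbf{u}):=+\infty$ if the trajectory blows up in finite time. The optimal value function is $v^*(x):=\inf_{\mathbf{u}\in\mathcal{U}_\infty}J_\infty(x,\mathbf{u})$ (allowed to be $+\infty$ in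 general). "$v^*\in C^1(\Omega,\mathbb{R})$" means that $v^*$ is finite on $\Omega$ and its restriction to $\Omega$ is continuously differentiable. *)

theory Defs
  imports "HOL-Analysis.Analysis"
begin

text \<open>Meant for open sets \<open>S\<close>: the derivative is the full derivative at each point of \<open>S\<close>,
  and it depends continuously on the point with respect to the operator norm.\<close>

definition C1_on :: "'a::euclidean_space set \<Rightarrow> ('a \<Rightarrow> 'b::real_normed_vector) \<Rightarrow> bool" where
  "C1_on S F \<longleftrightarrow> (\<exists>F' :: 'a \<Rightarrow> 'a \<Rightarrow>\<^sub>L 'b.
     (\<forall>x\<in>S. (F has_derivative blinfun_apply (F' x)) (at x)) \<and> continuous_on S F')"

definition grad :: "('a::real_inner \<Rightarrow> real) \<Rightarrow> 'a \<Rightarrow> 'a" where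
  "grad v x = (THE D. GDERIV v x :> D)"

definition sym_pos_def :: "real^'k^'k \<Rightarrow> bool" where
  "sym_pos_def A \<longleftrightarrow> transpose A = A \<and> (\<forall>y. y \<noteq> 0 \<longrightarrow> y \<bullet> (A *v y) > 0)"

definition weighted_norm :: "real^'k^'k \<Rightarrow> real^'k \<Rightarrow> real" where
  "weighted_norm A y = sqrt (y \<bullet> (A *v y))"

definition standing_assumptions ::
  "(real^'n \<Rightarrow> real^'n) \<Rightarrow> (real^'n \<Rightarrow> real^'m^'n) \<Rightarrow> (real^'n \<Rightarrow> real) \<Rightarrow> real^'m^'m \<Rightarrow> bool" where
  "standing_assumptions f g h R \<longleftrightarrow>
     C1_on UNIV f \<and> C1_on UNIV g \<and> C1_on UNIV h \<and> sym_pos_def R \<and>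
     f 0 = 0 \<and> h 0 = 0 \<and> (\<forall>x. x \<noteq> 0 \<longrightarrow> h x > 0)"

text \<open>Elements of \<open>L\<^sup>\<infinity>([0,\<infinity>); \<real>\<^sup>M)\<close> are given by representatives; values at negative times are
  irrelevant.\<close>

definition Linf_controls :: "(real \<Rightarrow> real^'m) set" where
  "Linf_controls = {u. u \<in> borel_measurable (lebesgue_on {0..}) \<and>
     (\<exists>C. AE t in lebesgue_on {0..}. norm (u t) \<le> C)}"

text \<open>Absolute continuity on a compact real interval. In a division, the members \<open>K\<close> are
  non-overlapping compact intervals \<open>[Inf K, Sup K]\<close>; they need not cover \<open>{a..b}\<close>.\<close>

definition abs_continuous_on_interval ::
    "real \<Rightarrow> real \<Rightarrow> (real \<Rightarrow> 'a::real_normed_vector) \<Rightarrow> bool" where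
  "abs_continuous_on_interval a b y \<longleftrightarrow>
     (\<forall>\<epsilon>>0. \<exists>\<delta>>0. \<forall>d S. d division_of S \<and> S \<subseteq> {a..b} \<and> (\<Sum>K\<in>d. Sup K - Inf K) < \<delta> \<longrightarrow>
        (\<Sum>K\<in>d. norm (y (Sup K) - y (Inf K))) < \<epsilon>)"

text \<open>\<open>y\<close> is a Caratheodory solution on \<open>[0,T)\<close> with initial value \<open>x\<close>, where
  \<open>0 < T \<le> \<infinity>\<close>.\<close>

definition caratheodory_solution ::
  "(real^'n \<Rightarrow> real^'n) \<Rightarrow> (real^'n \<Rightarrow> real^'m^'n) \<Rightarrow> (real \<Rightarrow> real^'m) \<Rightarrow> real^'n \<Rightarrow>
   ereal \<Rightarrow> (real \<Rightarrow> real^'n) \<Rightarrow> bool" where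
  "caratheodory_solution f g u x T y \<longleftrightarrow>
     0 < T \<and> y 0 = x \<and>
     (\<forall>b\<ge>0. ereal b < T \<longrightarrow> abs_continuous_on_interval 0 b y) \<and>
     (AE t in lebesgue. 0 < t \<and> ereal t < T \<longrightarrow>
        (y has_vector_derivative (f (y t) + g (y t) *v u t)) (at t))"

text \<open>Solutions of the same initial value problem agree on the intersection of their intervals
  (\<open>f\<close> and \<open>g\<close> are locally Lipschitz), so the maximal solution is the union of all
  solutions: it lives on \<open>[0, escape_time)\<close> and its value at \<open>t\<close> is the common value at
  \<open>t\<close> of all solutions defined there. It blows up in finite time iff
  \<open>escape_time < \<infinity>\<close>.\<close>

definition escape_time ::
  "(real^'n \<Rightarrow> real^'n) \<Rightarrow> (real^'n \<Rightarrow> real^'m^'n) \<Rightarrow> (real \<Rightarrow> real^'m) \<Rightarrow> real^'n \<Rightarrow> ereal" where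
  "escape_time f g u x = Sup {T. \<exists>y. caratheodory_solution f g u x T y}"

definition trajectory ::
  "(real^'n \<Rightarrow> real^'n) \<Rightarrow> (real^'n \<Rightarrow> real^'m^'n) \<Rightarrow> (real \<Rightarrow> real^'m) \<Rightarrow> real^'n \<Rightarrow>
   real \<Rightarrow> real^'n" where
  "trajectory f g u x t =
     (THE z. \<exists>T y. caratheodory_solution f g u x T y \<and> ereal t < T \<and> z = y t)"

text \<open>The running cost is nonnegative under the standing assumptions, so \<open>ennreal\<close> does not
  truncate.\<close>

definition cost ::
  "(real^'n \<Rightarrow> real^'n) \<Rightarrow> (real^'n \<Rightarrow> real^'m^'n) \<Rightarrow> (real^'n \<Rightarrow> real) \<Rightarrow> real^'m^'m \<Rightarrow>
   real^'n \<Rightarrow> (real \<Rightarrow> real^'m) \<Rightarrow> ennreal" where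
  "cost f g h R x u =
     (if escape_time f g u x = \<infinity>
      then \<integral>\<^sup>+t\<in>{0..}. ennreal (h (trajectory f g u x t) + u t \<bullet> (R *v u t)) \<partial>lebesgue
      else \<infinity>)"

definition value_function ::
  "(real^'n \<Rightarrow> real^'n) \<Rightarrow> (real^'n \<Rightarrow> real^'m^'n) \<Rightarrow> (real^'n \<Rightarrow> real) \<Rightarrow> real^'m^'m \<Rightarrow>
   real^'n \<Rightarrow> ennreal" where
  "value_function f g h R x = (INF u\<in>Linf_controls. cost f g h R x u)"

definition feedback ::
  "(real^'n \<Rightarrow> real^'m^'n) \<Rightarrow> real^'m^'m \<Rightarrow> (real^'n \<Rightarrow> real) \<Rightarrow> real^'n \<Rightarrow> real^'m" where
  "feedback g R v x = - (1/2) *\<^sub>R (matrix_inv R *v (transpose (g x) *v grad v x))"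

end

theory Submission
  imports Defs "HOL-Complex_Analysis.Great_Picard"
begin

text \<open>With \<open>w = feedback g R v\<close>, completing the square in the Hamilton-Jacobi-Bellman equation
  shows that along every trajectory \<open>v\<close> changes at the rate minus the running cost plus
  \<open>\<parallel>u - w\<parallel>\<^sub>R\<^sup>2\<close>, as long as the trajectory stays in a closed ball inside \<open>\<Omega>\<close>.
  Starting close to the origin, the closed loop \<open>u = w\<close> stays in the ball because of the quadratic
  bounds, and its cost is at most \<open>v x\<close>; hence \<open>v\<^sup>* \<le> v\<close>. Conversely, a trajectory of finite cost that
  stays in the ball must come arbitrarily close to the origin, where \<open>v\<close> is small, so its cost
  is at least \<open>v x\<close>. It can only leave through a small sphere on which, by dynamic programming, its
  cost would be at least the minimum of \<open>v\<^sup>*\<close>, which is positive; a near-optimal control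
  starting close to the origin cannot afford this. Only this minimum, \<open>\<Omega>\<close>, \<open>\<alpha>\<close> and \<open>\<beta>\<close> enter the
  choice of the neighbourhood.\<close>

section \<open>Absolutely continuous functions\<close>

text \<open>As \<open>v\<close> is only C1, \<open>grad v\<close> and the feedback are merely
  continuous, so the closed loop may have several solutions. Any one of them will do: once a
  closed-loop trajectory \<open>y\<close> is fixed, \<open>w (y t)\<close> is read as an open-loop
  control, and for a given control uniqueness follows from the smoothness of \<open>f\<close> and
  \<open>g\<close>. A second obstacle is that a small cost limits the control only in the L2 sense,
  so there is no common speed bound for trajectories. The function \<open>v\<close> is used as a
  measure of distance instead: it grows at a rate of at most the running cost plus a constant. The
  radii are chosen with \<open>\<beta> * s\<^sup>2 < \<alpha> * r\<^sup>2\<close>, so that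
  \<open>v\<close> on the sphere of radius \<open>s\<close> lies below \<open>v\<close> on the
  sphere of radius \<open>r\<close> by a definite gap, which must be climbed in order to leave the
  ball. Finally, the neighbourhood precedes the data and the candidate, while positivity of the
  optimal value on the small sphere is proved with the help of a candidate. The constant is
  therefore selected from \<open>vstar\<close> alone; a candidate only shows that the selection
  succeeds.\<close>

lemma division_of_real_interval:
  fixes S :: "real set"
  assumes "d division_of S" "K \<in> d"
  shows "\<exists>u v. u \<le> v \<and> K = {u..v} \<and> {u..v} \<subseteq> S"
proof -
  obtain u v where K: "K = cbox u v" using division_ofD(4)[OF assms] by blast
  show ?thesis
  proof (intro exI conjI)
    show "u \<le> v" using division_ofD(3)[OF assms] unfolding K by simp
    show "K = {u..v}" unfolding K by simp
    show "{u..v} \<subseteq> S" using division_ofD(2)[OF assms] unfolding K by simp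
  qed
qed

text \<open>Fixing both \<open>\<epsilon>\<close> and \<open>\<delta>\<close> splits the alternating
  quantifiers, so that moduli can be passed between functions by plain introduction and destruction
  rules.\<close>

definition ac_modulus :: "real \<Rightarrow> real \<Rightarrow> (real \<Rightarrow> 'a::real_normed_vector) \<Rightarrow> real \<Rightarrow> real \<Rightarrow> bool" where
  "ac_modulus a b y \<epsilon> \<delta> \<longleftrightarrow> \<delta> > 0 \<and>
     (\<forall>d S. d division_of S \<and> S \<subseteq> {a..b} \<and> (\<Sum>K\<in>d. Sup K - Inf K) < \<delta> \<longrightarrow>
        (\<Sum>K\<in>d. norm (y (Sup K) - y (Inf K))) < \<epsilon>)"

lemma AC_iff_modulus:
  "abs_continuous_on_interval a b y \<longleftrightarrow> (\<forall>\<epsilon>>0. \<exists>\<delta>. ac_modulus a b y \<epsilon> \<delta>)"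
  unfolding abs_continuous_on_interval_def ac_modulus_def ..

lemma ac_modulusD:
  assumes "ac_modulus a b y \<epsilon> \<delta>"
  shows "\<delta> > 0"
    "\<And>d S. d division_of S \<Longrightarrow> S \<subseteq> {a..b} \<Longrightarrow> (\<Sum>K\<in>d. Sup K - Inf K) < \<delta> \<Longrightarrow>
        (\<Sum>K\<in>d. norm (y (Sup K) - y (Inf K))) < \<epsilon>"
  using assms unfolding ac_modulus_def by blast+

lemma ac_modulusI:
  assumes "\<delta> > 0"
    "\<And>d S. d division_of S \<Longrightarrow> S \<subseteq> {a..b} \<Longrightarrow> (\<Sum>K\<in>d. Sup K - Inf K) < \<delta> \<Longrightarrow>
        (\<Sum>K\<in>d. norm (y (Sup K) - y (Inf K))) < \<epsilon>"
  shows "ac_modulus a b y \<epsilon> \<delta>"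
  using assms unfolding ac_modulus_def by blast

text \<open>One estimate serves for Lipschitz functions, negatives, differences, products and
  composition with a Lipschitz map: in each case the increments are bounded by those of at most two
  absolutely continuous functions.\<close>

lemma AC_dominated:
  assumes p: "abs_continuous_on_interval a b p" and q: "abs_continuous_on_interval a b q"
    and "A \<ge> 0" "B \<ge> 0"
    and le: "\<And>s t. s \<in> {a..b} \<Longrightarrow> t \<in> {a..b} \<Longrightarrow>
      norm (y t - y s) \<le> A * norm (p t - p s) + B * norm (q t - q s)"
  shows "abs_continuous_on_interval a b y"
  unfolding AC_iff_modulus
proof (intro allI impI)
  fix \<epsilon> :: real assume "\<epsilon> > 0"
  \<comment> \<open>The extra 1 keeps the denominator positive when \<open>A\<close> and
    \<open>B\<close> vanish and makes the final estimate strict.\<close>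
  define e where "e = \<epsilon> / (A + B + 1)"
  have "e > 0" unfolding e_def using \<open>\<epsilon> > 0\<close> \<open>A \<ge> 0\<close> \<open>B \<ge> 0\<close> by simp
  obtain d1 where d10: "ac_modulus a b p e d1" using p[unfolded AC_iff_modulus] \<open>e > 0\<close> by blast
  note d1 = ac_modulusD[OF d10]
  obtain d2 where d20: "ac_modulus a b q e d2" using q[unfolded AC_iff_modulus] \<open>e > 0\<close> by blast
  note d2 = ac_modulusD[OF d20]
  show "\<exists>\<delta>. ac_modulus a b y \<epsilon> \<delta>"
  proof (intro exI, rule ac_modulusI[of "min d1 d2"])
    show "min d1 d2 > 0" using d1 d2 by auto
    fix d S assume D: "d division_of S" "S \<subseteq> {a..b}" "(\<Sum>K\<in>d. Sup K - Inf K) < min d1 d2"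
    have "(\<Sum>K\<in>d. norm (y (Sup K) - y (Inf K)))
        \<le> (\<Sum>K\<in>d. A * norm (p (Sup K) - p (Inf K)) + B * norm (q (Sup K) - q (Inf K)))"
    proof (rule sum_mono)
      fix K assume "K \<in> d"
      then obtain u v where K: "u \<le> v" "K = {u..v}" "{u..v} \<subseteq> S"
        using division_of_real_interval[of d S K] D by blast
      have S: "S \<subseteq> {a..b}" using D by blast
      show "norm (y (Sup K) - y (Inf K)) \<le> A * norm (p (Sup K) - p (Inf K)) + B * norm (q (Sup K) - q (Inf K))"
      proof (rule le)
        have "Inf K = u" "Sup K = v" "{u..v} \<subseteq> {a..b}" using K S by (auto simp del: atLeastatMost_subset_iff)
        then show "Inf K \<in> {a..b}" "Sup K \<in> {a..b}" using K(1) by auto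
      qed
    qed
    also have "\<dots> = A * (\<Sum>K\<in>d. norm (p (Sup K) - p (Inf K))) + B * (\<Sum>K\<in>d. norm (q (Sup K) - q (Inf K)))"
      by (simp add: sum.distrib sum_distrib_left)
    also have "\<dots> \<le> A * e + B * e"
    proof -
      from D have "d division_of S" "S \<subseteq> {a..b}" "(\<Sum>K\<in>d. Sup K - Inf K) < d1" "(\<Sum>K\<in>d. Sup K - Inf K) < d2"
        by simp_all
      then have "(\<Sum>K\<in>d. norm (p (Sup K) - p (Inf K))) \<le> e" "(\<Sum>K\<in>d. norm (q (Sup K) - q (Inf K))) \<le> e"
        using d1(2)[of d S] d2(2)[of d S] by linarith+
      then show ?thesis
        by (intro add_mono mult_left_mono \<open>A \<ge> 0\<close> \<open>B \<ge> 0\<close>)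
    qed
    also have "\<dots> < (A + B + 1) * e" using \<open>e > 0\<close> by (simp add: algebra_simps)
    also have "\<dots> = \<epsilon>" unfolding e_def using \<open>A \<ge> 0\<close> \<open>B \<ge> 0\<close> by simp
    finally show "(\<Sum>K\<in>d. norm (y (Sup K) - y (Inf K))) < \<epsilon>" by simp
  qed
qed

lemma AC_ident: "abs_continuous_on_interval a b (\<lambda>t::real. t)"
  unfolding AC_iff_modulus
proof (intro allI impI)
  fix \<epsilon> :: real assume "\<epsilon> > 0"
  have eq: "(\<Sum>K\<in>d. norm (Sup K - Inf K)) = (\<Sum>K\<in>d. Sup K - Inf K)"
    if dS: "d division_of S" for d and S :: "real set"
  proof (rule sum.cong)
    fix K assume "K \<in> d"
    then obtain u v where "u \<le> v" "K = {u..v}" using division_of_real_interval[OF dS] by blast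
    then show "norm (Sup K - Inf K) = Sup K - Inf K" by auto
  qed auto
  show "\<exists>\<delta>. ac_modulus a b (\<lambda>t. t) \<epsilon> \<delta>"
  proof (intro exI, rule ac_modulusI[of \<epsilon>])
    fix d S assume D: "d division_of S" "S \<subseteq> {a..b}" "(\<Sum>K\<in>d. Sup K - Inf K) < \<epsilon>"
    then show "(\<Sum>K\<in>d. norm (Sup K - Inf K)) < \<epsilon>" using eq[of d S] by linarith
  qed fact
qed

lemma AC_lipschitz:
  assumes "L \<ge> 0" "\<And>s t. s \<in> {a..b} \<Longrightarrow> t \<in> {a..b} \<Longrightarrow> norm (y t - y s) \<le> L * \<bar>t - s\<bar>"
  shows "abs_continuous_on_interval a b y"
  by (rule AC_dominated[OF AC_ident AC_ident, of L 0]) (use assms in auto)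

lemma AC_subset:
  assumes y: "abs_continuous_on_interval a b y" and sub: "{c..d'} \<subseteq> {a..b}"
  shows "abs_continuous_on_interval c d' y"
  unfolding AC_iff_modulus
proof (intro allI impI)
  fix \<epsilon> :: real assume "\<epsilon> > 0"
  then obtain \<delta> where \<delta>: "ac_modulus a b y \<epsilon> \<delta>" using y[unfolded AC_iff_modulus] by blast
  have "ac_modulus c d' y \<epsilon> \<delta>"
    by (rule ac_modulusI) (use ac_modulusD[OF \<delta>] order_trans[OF _ sub] in simp_all)
  then show "\<exists>\<delta>. ac_modulus c d' y \<epsilon> \<delta>" by (rule exI)
qed

text \<open>Translation maps divisions to divisions of the same total length. This is what allows a
  trajectory to be restarted at a later time.\<close>

lemma AC_shift:
  assumes "abs_continuous_on_interval (a + s) (b + s) y"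
  shows "abs_continuous_on_interval a b (\<lambda>t. y (s + t))"
  unfolding AC_iff_modulus
proof (intro allI impI)
  fix \<epsilon> :: real assume "\<epsilon> > 0"
  obtain \<delta> where \<delta>0: "ac_modulus (a + s) (b + s) y \<epsilon> \<delta>" using assms[unfolded AC_iff_modulus] \<open>\<epsilon> > 0\<close> by blast
  note \<delta> = ac_modulusD[OF \<delta>0]
  show "\<exists>\<delta>. ac_modulus a b (\<lambda>t. y (s + t)) \<epsilon> \<delta>"
  proof (intro exI, rule ac_modulusI[of \<delta>])
    fix d S assume D: "d division_of S" "S \<subseteq> {a..b}" "(\<Sum>K\<in>d. Sup K - Inf K) < \<delta>"
    define T where "T = (+) s"
    have inj: "inj_on ((`) T) d" unfolding T_def by (rule inj_onI) (simp add: inj_image_eq_iff)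
    have *: "Sup (T ` K) = s + Sup K" "Inf (T ` K) = s + Inf K" if "K \<in> d" for K
    proof -
      obtain u v where K: "u \<le> v" "K = {u..v}" using division_of_real_interval[of d S K] D \<open>K \<in> d\<close> by blast
      have "T ` K = {s+u..s+v}" unfolding T_def K(2) by (simp add: image_add_atLeastAtMost add.commute)
      then show "Sup (T ` K) = s + Sup K" "Inf (T ` K) = s + Inf K" using K by simp_all
    qed
    have div: "((`) T) ` d division_of (T ` S)"
    proof (rule division_ofI)
      have dS: "d division_of S" using D by blast
      show "finite ((`) T ` d)" using dS by blast
      show "\<Union> ((`) T ` d) = T ` S" using division_ofD(6)[OF dS] by blast
      fix K assume "K \<in> (`) T ` d"
      then obtain K' where K': "K' \<in> d" "K = T ` K'" by blast
      obtain u v where uv: "u \<le> v" "K' = {u..v}" "{u..v} \<subseteq> S" using division_of_real_interval[OF dS K'(1)] by blast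
      have Kuv: "K = {s+u..s+v}" unfolding T_def K' uv(2) by (simp add: image_add_atLeastAtMost add.commute)
      show "K \<subseteq> T ` S" unfolding K' uv(2) using uv(3) by (rule image_mono)
      show "K \<noteq> {}" unfolding K' uv(2) using uv(1) by simp
      show "\<exists>a b. K = cbox a b" unfolding Kuv using box_real(2)[symmetric] by blast
      fix L assume L: "L \<in> (`) T ` d" "K \<noteq> L"
      then obtain L' where L': "L' \<in> d" "L = T ` L'" "K' \<noteq> L'" using K' by blast
      then have "interior K' \<inter> interior L' = {}" using division_ofD(5)[OF dS] K' by blast
      then show "interior K \<inter> interior L = {}"
        using translation_Int[of s "interior K'" "interior L'"]
        unfolding K'(2) L'(2) T_def interior_translation by simp
    qed
    have "(\<Sum>K\<in>((`) T) ` d. Sup K - Inf K) = (\<Sum>K\<in>d. (s + Sup K) - (s + Inf K))"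
      unfolding sum.reindex[OF inj] o_def by (intro sum.cong refl) (simp only: *)
    moreover have "(\<Sum>K\<in>((`) T) ` d. norm (y (Sup K) - y (Inf K))) = (\<Sum>K\<in>d. norm (y (s + Sup K) - y (s + Inf K)))"
      unfolding sum.reindex[OF inj] o_def by (intro sum.cong refl) (simp only: *)
    moreover have "T ` S \<subseteq> {a+s..b+s}" using D(2) unfolding T_def by auto
    ultimately show "(\<Sum>K\<in>d. norm (y (s + Sup K) - y (s + Inf K))) < \<epsilon>"
      using \<delta>(2)[OF div] D by simp
  qed fact
qed

lemma AC_continuous_on:
  assumes y: "abs_continuous_on_interval a b y"
  shows "continuous_on {a..b} y"
  unfolding continuous_on_iff
proof (intro ballI allI impI)
  fix t e :: real assume t: "t \<in> {a..b}" and "e > 0"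
  obtain \<delta> where \<delta>0: "ac_modulus a b y e \<delta>" using y[unfolded AC_iff_modulus] \<open>e > 0\<close> by blast
  note \<delta> = ac_modulusD[OF \<delta>0]
  have le: "norm (y v - y u) < e" if "u \<in> {a..b}" "v \<in> {a..b}" "u \<le> v" "v - u < \<delta>" for u v
  proof -
    have "{cbox u v} division_of cbox u v" using division_of_self[of u v] \<open>u \<le> v\<close> by simp
    then have "{{u..v}} division_of {u..v}" unfolding box_real(2) .
    moreover have "{u..v} \<subseteq> {a..b}" using that by auto
    ultimately have "(\<Sum>K\<in>{{u..v}}. norm (y (Sup K) - y (Inf K))) < e"
      using \<delta>(2)[of "{{u..v}}" "{u..v}"] \<open>u \<le> v\<close> \<open>v - u < \<delta>\<close> by simp
    then show ?thesis using \<open>u \<le> v\<close> by simp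
  qed
  show "\<exists>d>0. \<forall>s\<in>{a..b}. dist s t < d \<longrightarrow> dist (y s) (y t) < e"
  proof (intro exI[of _ \<delta>] conjI ballI impI)
    fix s assume s: "s \<in> {a..b}" "dist s t < \<delta>"
    show "dist (y s) (y t) < e"
      using le[OF s(1) t] le[OF t s(1)] s(2)
      by (cases "s \<le> t") (auto simp: dist_norm norm_minus_commute)
  qed fact
qed

text \<open>On tags outside the null set the usual straddling estimate applies; the intervals tagged in
  the null set lie in an open set of small measure, so absolute continuity makes their
  contribution small.\<close>

lemma AC_has_integral:
  fixes y :: "real \<Rightarrow> 'a::banach"
  assumes "a \<le> b" and y: "abs_continuous_on_interval a b y" and N: "negligible N"
    and der: "\<And>t. t \<in> {a..b} - N \<Longrightarrow> (y has_vector_derivative y' t) (at t within {a..b})"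
  shows "(y' has_integral (y b - y a)) {a..b}"
proof -
  \<comment> \<open>With integrand 0 on \<open>N\<close>, an interval tagged there contributes only
    the increment of \<open>y\<close>, which absolute continuity controls.\<close>
  define z where "z t = (if t \<in> N then 0 else y' t)" for t
  have "(z has_integral (y b - y a)) {a..b}"
  proof (cases "a = b")
    case True
    then show ?thesis by auto
  next
    case False
    with \<open>a \<le> b\<close> have "a < b" by simp
    show ?thesis
      unfolding has_integral_factor_content box_real[symmetric]
    proof (intro allI impI)
      fix e' :: real
      assume "e' > 0"
      \<comment> \<open>One half of the error pays for tags outside \<open>N\<close>, the other for
        tags in \<open>N\<close>.\<close>
      define e where "e = e' / 2"
      then have "e > 0" using \<open>e' > 0\<close> by simp
      have "\<forall>x. \<exists>d. 0 < d \<and> (x \<in> {a..b} - N \<longrightarrow>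
             (\<forall>s\<in>{a..b}. norm (s-x) < d \<longrightarrow> norm (y s - y x - (s-x) *\<^sub>R y' x) \<le> e * norm (s-x)))"
      proof
        fix x
        show "\<exists>d. 0 < d \<and> (x \<in> {a..b} - N \<longrightarrow>
             (\<forall>s\<in>{a..b}. norm (s-x) < d \<longrightarrow> norm (y s - y x - (s-x) *\<^sub>R y' x) \<le> e * norm (s-x)))"
        proof (cases "x \<in> {a..b} - N")
          case True
          have "\<exists>d>0. \<forall>s\<in>{a..b}. norm (s-x) < d \<longrightarrow> norm (y s - y x - (s-x) *\<^sub>R y' x) \<le> e * norm (s-x)"
            using der[OF True] \<open>e > 0\<close> unfolding has_vector_derivative_def has_derivative_within_alt by simp
          then show ?thesis by blast
        next
          case False
          then show ?thesis using zero_less_one by blast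
        qed
      qed
      from choice[OF this] obtain d where d': "\<forall>x. 0 < d x \<and> (x \<in> {a..b} - N \<longrightarrow>
             (\<forall>s\<in>{a..b}. norm (s-x) < d x \<longrightarrow> norm (y s - y x - (s-x) *\<^sub>R y' x) \<le> e * norm (s-x)))" ..
      then have d: "\<And>x. 0 < d x" "\<And>x s. \<lbrakk>x \<in> {a..b} - N; s \<in> {a..b}; norm (s-x) < d x\<rbrakk>
                            \<Longrightarrow> norm (y s - y x - (s-x) *\<^sub>R y' x) \<le> e * norm (s-x)"
        by simp_all
      have "e * (b - a) > 0" using \<open>e > 0\<close> \<open>a < b\<close> by simp
      obtain \<delta> where \<delta>0: "ac_modulus a b y (e * (b - a)) \<delta>" using y[unfolded AC_iff_modulus] \<open>e * (b - a) > 0\<close> by blast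
      note \<delta> = ac_modulusD[OF \<delta>0]
      have Nl: "N \<in> sets lebesgue" "emeasure lebesgue N = 0"
        using N by (auto simp: negligible_iff_null_sets)
      obtain U where U: "open U" "N \<subseteq> U" "U - N \<in> lmeasurable" "emeasure lebesgue (U - N) < ennreal \<delta>"
        by (rule sets_lebesgue_outer_open[OF Nl(1) \<delta>(1)])
      have Um: "U \<in> sets lebesgue" using borel_open[OF U(1)] sets_completionI_sets[of U lborel] by simp
      have UN: "U = (U - N) \<union> N" using U(2) by blast
      have "emeasure lebesgue U \<le> emeasure lebesgue (U - N) + emeasure lebesgue N"
        by (subst UN, rule emeasure_subadditive) (use U(3) Nl(1) in \<open>simp_all add: fmeasurableD\<close>)
      then have mU: "emeasure lebesgue U < ennreal \<delta>" unfolding Nl(2) using U(4) by simp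
      then have "emeasure lebesgue U < \<infinity>" using ennreal_less_top[of \<delta>] less_trans[OF mU] by simp
      then have Ulm: "U \<in> lmeasurable" using Um by (simp add: fmeasurable_def)
      have mU': "measure lebesgue U < \<delta>"
        using mU unfolding emeasure_eq_measure2[OF Ulm] by (simp add: ennreal_less_iff)
      have "\<forall>x. \<exists>r. r > 0 \<and> (x \<in> N \<longrightarrow> ball x r \<subseteq> U)"
      proof
        fix x show "\<exists>r. r > 0 \<and> (x \<in> N \<longrightarrow> ball x r \<subseteq> U)"
        proof (cases "x \<in> N")
          case True
          then show ?thesis using openE[OF U(1), of x] U(2) by blast
        next
          case False
          then show ?thesis using zero_less_one by blast
        qed
      qed
      from choice[OF this] obtain r where r': "\<forall>x. r x > 0 \<and> (x \<in> N \<longrightarrow> ball x (r x) \<subseteq> U)" ..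
      then have r: "\<And>x. r x > 0" "\<And>x. x \<in> N \<Longrightarrow> ball x (r x) \<subseteq> U" by simp_all
      show "\<exists>g. gauge g \<and> (\<forall>p. p tagged_division_of (cbox a b) \<and> g fine p \<longrightarrow>
        norm ((\<Sum>(x, k)\<in>p. measure lborel k *\<^sub>R z x) - (y b - y a)) \<le> e' * measure lborel (cbox a b))"
      proof (intro exI conjI allI impI; (elim conjE)?)
        show "gauge (\<lambda>x. ball x (min (d x) (r x)))"
          using d(1) r(1) by (intro gauge_ball_dependent) auto
      next
        fix p
        assume ptag: "p tagged_division_of cbox a b" and finep: "(\<lambda>x. ball x (min (d x) (r x))) fine p"
        have ba: "b - a = (\<Sum>(x,K)\<in>p. Sup K - Inf K)" "y b - y a = (\<Sum>(x,K)\<in>p. y(Sup K) - y(Inf K))"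
          using additive_tagged_division_1[where f= "\<lambda>x. x"] additive_tagged_division_1[where f= y]
                \<open>a \<le> b\<close> ptag by auto
        have finp: "finite p" using ptag by blast
        define pN where "pN = {(x,K) \<in> p. x \<in> N}"
        have pNp: "pN \<subseteq> p" unfolding pN_def by auto
        have pbox: "\<exists>u v. u \<le> v \<and> K = {u..v} \<and> x \<in> {u..v} \<and> {u..v} \<subseteq> {a..b}
              \<and> {u..v} \<subseteq> ball x (min (d x) (r x)) \<and> Sup K = v \<and> Inf K = u \<and> measure lborel K = v - u" if xKp: "(x,K) \<in> p" for x K
        proof -
          obtain u v where "K = cbox u v" using ptag xKp by blast
          moreover have "x \<in> K" "K \<subseteq> {a..b}" using ptag that by auto
          moreover have "K \<subseteq> ball x (min (d x) (r x))" using finep that by blast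
          ultimately show ?thesis by (intro exI[of _ u] exI[of _ v]) auto
        qed
        have out: "norm (measure lborel K *\<^sub>R z x - (y (Sup K) - y (Inf K))) \<le> e * (Sup K - Inf K)"
          if xK: "(x,K) \<in> p" "x \<notin> N" for x K
        proof -
          obtain u v where uv: "u \<le> v" "K = {u..v}" "x \<in> {u..v}" "{u..v} \<subseteq> {a..b}"
              "{u..v} \<subseteq> ball x (min (d x) (r x))" "Sup K = v" "Inf K = u" "measure lborel K = v - u"
            using pbox[OF xK(1)] by blast
          have uvb: "u \<in> ball x (min (d x) (r x))" "v \<in> ball x (min (d x) (r x))" 
            using uv(1,5) by (meson atLeastAtMost_iff order_refl subsetD)+
          have *: "norm (y u - y x - (u-x) *\<^sub>R y' x) \<le> e * norm (u-x)" "norm (y v - y x - (v-x) *\<^sub>R y' x) \<le> e * norm (v-x)"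
            using uv xK uvb by (intro d(2); auto simp: dist_real_def)+
          have "norm ((v - u) *\<^sub>R y' x - (y v - y u)) = norm (y u - y x - (u - x) *\<^sub>R y' x - (y v - y x - (v - x) *\<^sub>R y' x))"
            by (simp add: algebra_simps)
          also have "\<dots> \<le> norm (y u - y x - (u - x) *\<^sub>R y' x) + norm (y v - y x - (v - x) *\<^sub>R y' x)"
            by (rule norm_triangle_ineq4)
          also have "\<dots> \<le> e * norm (u - x) + e * norm (v - x)" using * by linarith
          also have "\<dots> = e * (v - u)" using uv by (simp add: algebra_simps)
          finally show ?thesis using xK uv by (simp add: z_def)
        qed
        have *: "norm (measure lborel K *\<^sub>R z x - (y (Sup K) - y (Inf K)))
           \<le> e * (Sup K - Inf K) + (if x \<in> N then norm (y (Sup K) - y (Inf K)) else 0)" if "(x,K) \<in> p" for x K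
        proof (cases "x \<in> N")
          case True
          have "e * (Sup K - Inf K) \<ge> 0" using pbox[OF that] \<open>e > 0\<close> by auto
          then show ?thesis using True by (simp add: z_def norm_minus_commute)
        qed (use out that in auto)
        define dN where "dN = snd ` pN"
        have ptd: "pN tagged_division_of \<Union>dN"
          unfolding dN_def
        proof (rule tagged_partial_division_of_Union_self)
          show "pN tagged_partial_division_of {a..b}"
            using tagged_partial_division_subset[OF _ pNp] ptag
            unfolding tagged_division_of_def box_real by blast
        qed
        have dd: "dN division_of \<Union>dN"
          using division_of_tagged_division[OF ptd] unfolding dN_def .
        have sub: "\<Union>dN \<subseteq> {a..b} \<inter> U"
        proof
          fix t assume "t \<in> \<Union>dN"
          then obtain x K where xK: "(x,K) \<in> p" "x \<in> N" "t \<in> K" unfolding dN_def pN_def by auto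
          from pbox[OF xK(1)] have K: "K \<subseteq> {a..b}" "K \<subseteq> ball x (min (d x) (r x))" by blast+
          have "ball x (min (d x) (r x)) \<subseteq> ball x (r x)" by (rule subset_ball) simp
          with K xK(3) r(2)[OF xK(2)] show "t \<in> {a..b} \<inter> U" by blast
        qed
        have dbox: "Sup K - Inf K = measure lebesgue K" if KdN: "K \<in> dN" for K
        proof -
          obtain x where "(x, K) \<in> p" using KdN unfolding dN_def pN_def by auto
          then obtain u v where "u \<le> v" "K = {u..v}" using pbox by blast
          then show ?thesis by (simp add: measure_completion)
        qed
        have "(\<Sum>K\<in>dN. Sup K - Inf K) = (\<Sum>K\<in>dN. measure lebesgue K)" using dbox by (rule sum.cong[OF refl])
        also have "\<dots> = measure lebesgue (\<Union>dN)" using content_division[OF dd] by simp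
        also have "\<dots> \<le> measure lebesgue U"
          using sub Ulm lmeasurable_division[OF dd] by (intro measure_mono_fmeasurable) auto
        finally have "(\<Sum>K\<in>dN. Sup K - Inf K) < \<delta>" using mU' by simp
        with \<delta>(2)[OF dd] sub have small: "(\<Sum>K\<in>dN. norm (y (Sup K) - y (Inf K))) < e * (b - a)" by auto
        have eqN: "(\<Sum>(x,K)\<in>pN. norm (y (Sup K) - y (Inf K))) = (\<Sum>K\<in>dN. norm (y (Sup K) - y (Inf K)))"
        proof -
          \<comment> \<open>Passing from tagged pairs to intervals asks for a summand that vanishes
            on every box with empty interior. For one-point intervals this holds because
            \<open>Sup\<close> and \<open>Inf\<close> coincide; the empty box needs the default
            0.\<close>
          define D where "D K = (if K = {} then 0 else norm (y (Sup K) - y (Inf K)))" for K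
          have D0: "D (cbox u v) = 0" if "box u v = {}" for u v :: real
          proof -
            from that have "v \<le> u" by (simp add: box_real)
            then show ?thesis by (cases "u = v") (auto simp: D_def)
          qed
          have "(\<Sum>(x,K)\<in>pN. D K) = (\<Sum>K\<in>dN. D K)"
            unfolding dN_def using sum.over_tagged_division_lemma[OF ptd, of D] D0 by blast
          moreover have "(\<Sum>(x,K)\<in>pN. D K) = (\<Sum>(x,K)\<in>pN. norm (y (Sup K) - y (Inf K)))"
          proof (rule sum.cong[OF refl], safe)
            fix x K assume "(x, K) \<in> pN"
            then have "(x, K) \<in> p" using pNp by blast
            then have "K \<noteq> {}" using ptag by blast
            then show "D K = norm (y (Sup K) - y (Inf K))" by (simp add: D_def)
          qed
          moreover have "(\<Sum>K\<in>dN. D K) = (\<Sum>K\<in>dN. norm (y (Sup K) - y (Inf K)))"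
            by (rule sum.cong) (use division_ofD(3)[OF dd] in \<open>auto simp: D_def\<close>)
          ultimately show ?thesis by simp
        qed
        have "norm (\<Sum>(x, K) \<in> p. (measure lborel K *\<^sub>R z x) - (y (Sup K) - y (Inf K)))
              \<le> (\<Sum>(x,K)\<in>p. e * (Sup K - Inf K) + (if x \<in> N then norm (y (Sup K) - y (Inf K)) else 0))"
          by (rule sum_norm_le) (use * in auto)
        also have "\<dots> = e * (\<Sum>(x,K)\<in>p. Sup K - Inf K) + (\<Sum>(x,K)\<in>p. (if x \<in> N then norm (y (Sup K) - y (Inf K)) else 0))"
          by (simp add: sum.distrib sum_distrib_left case_prod_unfold)
        also have "(\<Sum>(x,K)\<in>p. (if x \<in> N then norm (y (Sup K) - y (Inf K)) else 0)) = (\<Sum>(x,K)\<in>pN. norm (y (Sup K) - y (Inf K)))"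
          by (rule sum.mono_neutral_cong_right[OF finp pNp]) (auto simp: pN_def split: if_splits)
        also have "e * (\<Sum>(x,K)\<in>p. Sup K - Inf K) + (\<Sum>(x,K)\<in>pN. norm (y (Sup K) - y (Inf K))) \<le> e * (b - a) + e * (b - a)"
          using ba(1) small eqN by (intro add_mono) auto
        also have "\<dots> = e' * measure lborel (cbox a b)" using \<open>a \<le> b\<close> unfolding e_def by simp
        finally show "norm ((\<Sum>(x, k)\<in>p. measure lborel k *\<^sub>R z x) - (y b - y a)) \<le> e' * measure lborel (cbox a b)"
          unfolding ba(2) by (simp add: sum_subtractf case_prod_unfold)
      qed
    qed
  qed
  then show ?thesis
    by (rule has_integral_spike[OF N, rotated]) (auto simp: z_def)
qed

section \<open>Peano's existence theorem\<close>

primrec euler_node :: "('a::real_normed_vector \<Rightarrow> 'a) \<Rightarrow> real \<Rightarrow> 'a \<Rightarrow> nat \<Rightarrow> 'a" where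
  "euler_node F \<tau> x 0 = x"
| "euler_node F \<tau> x (Suc k) = euler_node F \<tau> x k + \<tau> *\<^sub>R F (euler_node F \<tau> x k)"

text \<open>The Euler scheme is interpolated by a step function instead of the usual polygon:
  \<open>F\<close> along it is again a step function, whose integral up to a grid point is exactly
  the increment of the nodes.\<close>

definition euler_step :: "('a::real_normed_vector \<Rightarrow> 'a) \<Rightarrow> real \<Rightarrow> 'a \<Rightarrow> real \<Rightarrow> 'a" where
  "euler_step F \<tau> x t = euler_node F \<tau> x (nat \<lfloor>t / \<tau>\<rfloor>)"

lemma euler_node_diff:
  assumes M: "\<And>x. norm (F x) \<le> M" and "\<tau> > 0" "j \<le> k"
  shows "norm (euler_node F \<tau> x k - euler_node F \<tau> x j) \<le> M * (real k - real j) * \<tau>"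
  using \<open>j \<le> k\<close>
proof (induction k rule: dec_induct)
  case base
  then show ?case by simp
next
  case (step k)
  have "norm (euler_node F \<tau> x (Suc k) - euler_node F \<tau> x j)
      \<le> norm (euler_node F \<tau> x k - euler_node F \<tau> x j) + norm (\<tau> *\<^sub>R F (euler_node F \<tau> x k))"
    using norm_triangle_ineq[of "euler_node F \<tau> x k - euler_node F \<tau> x j" "\<tau> *\<^sub>R F (euler_node F \<tau> x k)"]
    by (simp add: algebra_simps)
  also have "\<dots> \<le> M * (real k - real j) * \<tau> + M * \<tau>"
  proof -
    have "\<tau> * norm (F (euler_node F \<tau> x k)) \<le> \<tau> * M"
      using M \<open>\<tau> > 0\<close> by (intro mult_left_mono) simp_all
    then have "norm (\<tau> *\<^sub>R F (euler_node F \<tau> x k)) \<le> M * \<tau>" using \<open>\<tau> > 0\<close> by (simp add: mult.commute)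
    then show ?thesis using step.IH by linarith
  qed
  also have "\<dots> = M * (real (Suc k) - real j) * \<tau>" by (simp add: algebra_simps)
  finally show ?case .
qed

text \<open>Two close times may lie on different sides of a grid point, so the Lipschitz bound holds
  only up to the error \<open>M * \<tau>\<close>, which vanishes in the limit.\<close>

lemma euler_step_diff:
  assumes M: "\<And>x. norm (F x) \<le> M" and \<tau>: "\<tau> > 0" and st: "0 \<le> s" "s \<le> t"
  shows "norm (euler_step F \<tau> x t - euler_step F \<tau> x s) \<le> M * (t - s + \<tau>)"
proof -
  have "M \<ge> 0" using norm_ge_zero[of "F undefined"] M[of undefined] by linarith
  define j k where "j = nat \<lfloor>s / \<tau>\<rfloor>" and "k = nat \<lfloor>t / \<tau>\<rfloor>"
  have "s / \<tau> \<le> t / \<tau>" using st \<tau> by (simp add: divide_right_mono)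
  then have "j \<le> k" unfolding j_def k_def by (intro nat_mono floor_mono)
  have "0 \<le> s / \<tau>" "0 \<le> t / \<tau>" using st \<tau> by simp_all
  then have "real k \<le> t / \<tau>" "s / \<tau> \<le> real j + 1" unfolding j_def k_def by linarith+
  then have "(real k - real j) * \<tau> \<le> (t / \<tau> - s / \<tau> + 1) * \<tau>" using \<tau> by (intro mult_right_mono) simp_all
  also have "\<dots> = t - s + \<tau>" using \<tau> by (simp add: field_simps)
  finally have le: "(real k - real j) * \<tau> \<le> t - s + \<tau>" .
  have "norm (euler_step F \<tau> x t - euler_step F \<tau> x s) \<le> M * ((real k - real j) * \<tau>)"
    using euler_node_diff[OF M \<tau> \<open>j \<le> k\<close>] unfolding euler_step_def j_def k_def by (simp add: mult.assoc)
  also have "\<dots> \<le> M * (t - s + \<tau>)" using le \<open>M \<ge> 0\<close> by (rule mult_left_mono)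
  finally show ?thesis .
qed

lemma euler_step_has_integral_node:
  fixes F :: "'a::banach \<Rightarrow> 'a"
  assumes \<tau>: "\<tau> > 0"
  shows "((\<lambda>s. F (euler_step F \<tau> x s)) has_integral (euler_node F \<tau> x k - x)) {0..real k * \<tau>}"
proof (induction k)
  case 0
  show ?case using has_integral_refl(1)[of _ "0::real"] by simp
next
  case (Suc k)
  define p where "p = euler_node F \<tau> x k"
  have "((\<lambda>s. F p) has_integral (real (Suc k) * \<tau> - real k * \<tau>) *\<^sub>R F p) {real k * \<tau>..real (Suc k) * \<tau>}"
    using has_integral_const_real[of "F p" "real k * \<tau>" "real (Suc k) * \<tau>"] \<tau> by simp
  then have c: "((\<lambda>s. F p) has_integral \<tau> *\<^sub>R F p) {real k * \<tau>..real (Suc k) * \<tau>}"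
    by (simp add: algebra_simps)
  \<comment> \<open>At the right end of the cell the floor has already jumped; that single point is
    removed as a spike.\<close>
  have e: "F (euler_step F \<tau> x s) = F p" if s: "s \<in> {real k * \<tau>..real (Suc k) * \<tau>} - {real (Suc k) * \<tau>}" for s
  proof -
    have "real k \<le> s / \<tau>" "s / \<tau> < real k + 1" using s by (simp_all add: pos_le_divide_eq[OF \<tau>] pos_divide_less_eq[OF \<tau>] algebra_simps)
    then have "\<lfloor>s / \<tau>\<rfloor> = int k" by (intro floor_unique) simp_all
    then show ?thesis unfolding euler_step_def p_def by simp
  qed
  have i: "((\<lambda>s. F (euler_step F \<tau> x s)) has_integral \<tau> *\<^sub>R F p) {real k * \<tau>..real (Suc k) * \<tau>}"
    by (rule has_integral_spike_finite[of "{real (Suc k) * \<tau>}", OF _ e c]) simp_all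
  have "0 \<le> real k * \<tau>" "real k * \<tau> \<le> real (Suc k) * \<tau>" using \<tau> by simp_all
  from has_integral_combine[OF this Suc.IH i] show ?case
    by (simp add: p_def algebra_simps)
qed

text \<open>The integral equation is exact at grid points; at other times the defect is the integral
  since the last grid point, over a length of at most \<open>\<tau>\<close>.\<close>

lemma euler_step_integral:
  fixes F :: "'a::banach \<Rightarrow> 'a"
  assumes M: "\<And>x. norm (F x) \<le> M" and \<tau>: "\<tau> > 0" and "t \<ge> 0"
  shows "(\<lambda>s. F (euler_step F \<tau> x s)) integrable_on {0..t}"
    and "norm (euler_step F \<tau> x t - x - integral {0..t} (\<lambda>s. F (euler_step F \<tau> x s))) \<le> M * \<tau>"
proof -
  define G where "G s = F (euler_step F \<tau> x s)" for s
  define k where "k = nat \<lfloor>t / \<tau>\<rfloor>"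
  have "0 \<le> t / \<tau>" using \<open>t \<ge> 0\<close> \<tau> by simp
  then have k: "real k \<le> t / \<tau>" "t / \<tau> \<le> real (Suc k)" unfolding k_def by linarith+
  then have kt: "real k * \<tau> \<le> t" "t \<le> real (Suc k) * \<tau>" using \<tau> by (simp_all add: field_simps)
  have k0: "0 \<le> real k * \<tau>" using \<tau> by simp
  have "G integrable_on {0..real (Suc k) * \<tau>}"
    unfolding G_def using euler_step_has_integral_node[OF \<tau>] by (rule has_integral_integrable)
  then have int: "G integrable_on {0..t}"
    by (rule integrable_subinterval_real) (use kt in auto)
  then show "(\<lambda>s. F (euler_step F \<tau> x s)) integrable_on {0..t}" unfolding G_def .
  have i1: "integral {0..real k * \<tau>} G = euler_step F \<tau> x t - x"
    unfolding G_def euler_step_def[of _ _ _ t] k_def[symmetric]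
    by (rule integral_unique[OF euler_step_has_integral_node[OF \<tau>]])
  have i2: "integral {0..real k * \<tau>} G + integral {real k * \<tau>..t} G = integral {0..t} G"
    using k0 kt(1) int by (rule Henstock_Kurzweil_Integration.integral_combine)
  have eq: "euler_step F \<tau> x t - x - integral {0..t} G = - integral {real k * \<tau>..t} G"
    unfolding i2[symmetric] i1[symmetric] by simp
  have int2: "G integrable_on {real k * \<tau>..t}"
    using int by (rule integrable_subinterval_real) (use k0 in auto)
  have "M \<ge> 0" using norm_ge_zero[of "F undefined"] M[of undefined] by linarith
  have "norm (integral {real k * \<tau>..t} G) \<le> integral {real k * \<tau>..t} (\<lambda>_. M)"
    by (rule integral_norm_bound_integral[OF int2]) (use M in \<open>auto simp: G_def\<close>)
  also have "\<dots> = M * (t - real k * \<tau>)" using kt by simp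
  also have "\<dots> \<le> M * \<tau>" using kt \<open>M \<ge> 0\<close> by (intro mult_left_mono) (simp_all add: algebra_simps)
  finally show "norm (euler_step F \<tau> x t - x - integral {0..t} (\<lambda>s. F (euler_step F \<tau> x s))) \<le> M * \<tau>"
    using eq unfolding G_def by simp
qed

text \<open>An Arzela-Ascoli argument for functions with jumps: a diagonal subsequence converges at
  the nonnegative rationals, and the almost-Lipschitz bound makes it Cauchy at every other time as
  the step sizes tend to 0.\<close>

lemma euler_subsequence_converges:
  fixes F :: "'a::euclidean_space \<Rightarrow> 'a"
  assumes M: "\<And>x. norm (F x) \<le> M"
  shows "\<exists>k::nat \<Rightarrow> nat. strict_mono k \<and>
    (\<forall>t\<ge>0. convergent (\<lambda>n. euler_step F (inverse (real (Suc (k n)))) x t))"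
proof -
  define Y where "Y n t = euler_step F (inverse (real (Suc n))) x t" for n t
  have \<tau>: "inverse (real (Suc n)) > 0" for n by simp
  have \<tau>1: "inverse (real (Suc n)) \<le> 1" for n by (simp add: field_simps)
  have "M \<ge> 0" using norm_ge_zero[of "F undefined"] M[of undefined] by linarith
  have Y0: "Y n 0 = x" for n by (simp add: Y_def euler_step_def)
  define S where "S = \<rat> \<inter> {0::real..}"
  have cS: "countable S" unfolding S_def using countable_rat by (rule countable_Int1)
  \<comment> \<open>The diagonal argument wants one bound for all times, but the approximations may
    grow linearly in \<open>t\<close>; dividing by \<open>1 + t\<close> restores a common
    bound.\<close>
  define B where "B = norm x + 2 * M"
  have bnd: "norm (Y n t /\<^sub>R (1 + t)) \<le> B" if "t \<in> S" for n t
  proof -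
    have t: "0 \<le> t" using that unfolding S_def by simp
    have "norm (Y n t) \<le> norm x + norm (Y n t - Y n 0)"
      using norm_triangle_sub[of "Y n t" x] unfolding Y0 by simp
    also have "\<dots> \<le> norm x + M * (t - 0 + inverse (real (Suc n)))"
      unfolding Y_def using euler_step_diff[OF M \<tau> order_refl t] by simp
    also have "\<dots> \<le> norm x + M * (t + 1)"
      using \<tau>1 \<open>M \<ge> 0\<close> by (intro add_left_mono mult_left_mono) simp_all
    also have "\<dots> \<le> B * (1 + t)"
      unfolding B_def using t \<open>M \<ge> 0\<close> by (simp add: algebra_simps)
    finally show ?thesis using t by (simp add: field_simps)
  qed
  have "\<exists>k::nat \<Rightarrow> nat. strict_mono k \<and> (\<forall>t\<in>S. \<exists>l. (\<lambda>n. Y (k n) t /\<^sub>R (1 + t)) \<longlonglongrightarrow> l)"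
  proof (rule function_convergent_subsequence[where f = "\<lambda>n t. Y n t /\<^sub>R (1 + t)", OF cS bnd])
    fix k :: "nat \<Rightarrow> nat"
    assume "strict_mono k" "\<And>t. t \<in> S \<Longrightarrow> \<exists>l. (\<lambda>n. Y (k n) t /\<^sub>R (1 + t)) \<longlonglongrightarrow> l"
    then show ?thesis by (intro exI[of _ k] conjI ballI)
  qed
  then obtain k :: "nat \<Rightarrow> nat" where k: "strict_mono k" "\<forall>t\<in>S. \<exists>l. (\<lambda>n. Y (k n) t /\<^sub>R (1 + t)) \<longlonglongrightarrow> l"
    by (elim exE conjE)
  have convS: "convergent (\<lambda>n. Y (k n) t)" if t: "t \<in> S" for t
  proof -
    obtain l where "(\<lambda>n. Y (k n) t /\<^sub>R (1 + t)) \<longlonglongrightarrow> l" using bspec[OF k(2) t] by (elim exE)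
    then have "(\<lambda>n. (1 + t) *\<^sub>R (Y (k n) t /\<^sub>R (1 + t))) \<longlonglongrightarrow> (1 + t) *\<^sub>R l" by (intro tendsto_intros)
    moreover have "1 + t \<noteq> 0" using t unfolding S_def by simp
    ultimately have "(\<lambda>n. Y (k n) t) \<longlonglongrightarrow> (1 + t) *\<^sub>R l" by simp
    then show ?thesis by (rule convergentI)
  qed
  have "convergent (\<lambda>n. Y (k n) t)" if t: "t \<ge> 0" for t
  proof -
    have "Cauchy (\<lambda>n. Y (k n) t)"
    proof (rule metric_CauchyI)
      fix e :: real assume "e > 0"
      \<comment> \<open>A time difference of at most \<open>d\<close> and a step size of at most
        \<open>d\<close> together move an approximation by at most a quarter of \<open>e\<close>,
        and three such quarters stay below \<open>e\<close>.\<close>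
      define d where "d = e / (8 * (M + 1))"
      have "d > 0" unfolding d_def using \<open>e > 0\<close> \<open>M \<ge> 0\<close> by simp
      have Md: "M * (2 * d) \<le> e / 4"
      proof -
        have "M * (2 * d) \<le> (M + 1) * (2 * d)" using \<open>d > 0\<close> by (intro mult_right_mono) simp_all
        also have "\<dots> = e / 4" unfolding d_def using \<open>M \<ge> 0\<close> by (simp add: field_simps)
        finally show ?thesis .
      qed
      obtain q where q: "q \<in> \<rat>" "t < q" "q < t + d" using Rats_dense_in_real[of t "t + d"] \<open>d > 0\<close> by auto
      then have qS: "q \<in> S" unfolding S_def using t by simp
      have "Cauchy (\<lambda>n. Y (k n) q)" using convS[OF qS] by (rule convergent_Cauchy)
      then obtain N1 where N1: "\<And>m n. m \<ge> N1 \<Longrightarrow> n \<ge> N1 \<Longrightarrow> dist (Y (k m) q) (Y (k n) q) < e / 4"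
        using metric_CauchyD[of "\<lambda>n. Y (k n) q" "e / 4"] \<open>e > 0\<close> by auto
      obtain N2 :: nat where N2: "inverse (real (Suc N2)) < d" using reals_Archimedean[OF \<open>d > 0\<close>] by auto
      have close: "dist (Y (k n) q) (Y (k n) t) \<le> e / 4" if n: "n \<ge> N2" for n
      proof -
        have "k n \<ge> N2" using seq_suble[OF k(1), of n] n by linarith
        then have "inverse (real (Suc (k n))) \<le> inverse (real (Suc N2))" by (simp add: field_simps)
        then have "inverse (real (Suc (k n))) \<le> d" using N2 by linarith
        have "dist (Y (k n) q) (Y (k n) t) \<le> M * (q - t + inverse (real (Suc (k n))))"
          unfolding dist_norm Y_def using q t by (intro euler_step_diff[OF M \<tau>]) simp_all
        also have "\<dots> \<le> M * (2 * d)"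
          using q \<open>inverse (real (Suc (k n))) \<le> d\<close> \<open>M \<ge> 0\<close> by (intro mult_left_mono) simp_all
        also note Md
        finally show ?thesis .
      qed
      show "\<exists>N. \<forall>m\<ge>N. \<forall>n\<ge>N. dist (Y (k m) t) (Y (k n) t) < e"
      proof (intro exI[of _ "max N1 N2"] allI impI)
        fix m n assume mn: "m \<ge> max N1 N2" "n \<ge> max N1 N2"
        have "dist (Y (k m) t) (Y (k n) t) \<le> dist (Y (k m) q) (Y (k m) t) + dist (Y (k m) q) (Y (k n) q) + dist (Y (k n) q) (Y (k n) t)"
          using dist_triangle[of "Y (k m) t" "Y (k n) t" "Y (k m) q"] dist_triangle[of "Y (k m) q" "Y (k n) t" "Y (k n) q"]
          by (simp add: dist_commute)
        also have "\<dots> < e" using close[of m] close[of n] N1[of m n] mn \<open>e > 0\<close> by simp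
        finally show "dist (Y (k m) t) (Y (k n) t) < e" .
      qed
    qed
    then show ?thesis by (simp add: Cauchy_convergent_iff)
  qed
  then show ?thesis unfolding Y_def by (intro exI[of _ k] conjI allI impI k(1))
qed

text \<open>Since \<open>F\<close> is continuous and bounded, the approximate integral equation
  passes to the limit by dominated convergence, for which pointwise convergence suffices.
  Boundedness also makes the solution global.\<close>

theorem peano_existence:
  fixes F :: "'a::euclidean_space \<Rightarrow> 'a"
  assumes F: "continuous_on UNIV F" and M: "\<And>x. norm (F x) \<le> M"
  obtains y where "y 0 = x" "\<And>s t. 0 \<le> s \<Longrightarrow> 0 \<le> t \<Longrightarrow> norm (y t - y s) \<le> M * \<bar>t - s\<bar>"
    "\<And>t. t > 0 \<Longrightarrow> (y has_vector_derivative F (y t)) (at t)"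
proof -
  obtain k :: "nat \<Rightarrow> nat" where k: "strict_mono k"
    "\<forall>t\<ge>0. convergent (\<lambda>n. euler_step F (inverse (real (Suc (k n)))) x t)"
    using euler_subsequence_converges[where F = F and x = x, OF M] by (elim exE conjE)
  define \<tau> where "\<tau> n = inverse (real (Suc (k n)))" for n
  have \<tau>pos: "\<tau> n > 0" for n unfolding \<tau>_def by simp
  have \<tau>0: "\<tau> \<longlonglongrightarrow> 0"
    unfolding \<tau>_def using LIMSEQ_subseq_LIMSEQ[OF LIMSEQ_inverse_real_of_nat k(1)] by (simp add: o_def)
  define Y where "Y n t = euler_step F (\<tau> n) x t" for n t
  define y where "y t = lim (\<lambda>n. Y n t)" for t
  have lim: "(\<lambda>n. Y n t) \<longlonglongrightarrow> y t" if "t \<ge> 0" for t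
    unfolding y_def Y_def \<tau>_def using k(2) that by (simp add: convergent_LIMSEQ_iff)
  have Y0: "Y n 0 = x" for n by (simp add: Y_def euler_step_def)
  then have "(\<lambda>n. Y n 0) \<longlonglongrightarrow> x" by simp
  with lim[OF order_refl] have y0: "y 0 = x" by (rule LIMSEQ_unique)
  have lip1: "norm (y t - y s) \<le> M * (t - s)" if st: "0 \<le> s" "s \<le> t" for s t
  proof (rule LIMSEQ_le)
    show "(\<lambda>n. norm (Y n t - Y n s)) \<longlonglongrightarrow> norm (y t - y s)"
      using st by (intro tendsto_intros lim) simp_all
    show "(\<lambda>n. M * (t - s + \<tau> n)) \<longlonglongrightarrow> M * (t - s)"
      using tendsto_mult[OF tendsto_const[of M] tendsto_add[OF tendsto_const[of "t - s"] \<tau>0]] by simp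
    show "\<exists>N. \<forall>n\<ge>N. norm (Y n t - Y n s) \<le> M * (t - s + \<tau> n)"
      unfolding Y_def by (intro exI allI impI euler_step_diff[OF M \<tau>pos st])
  qed
  have lip: "norm (y t - y s) \<le> M * \<bar>t - s\<bar>" if "0 \<le> s" "0 \<le> t" for s t
    using lip1[of s t] lip1[of t s] that by (cases "s \<le> t") (simp_all add: norm_minus_commute)
  have "M \<ge> 0" using norm_ge_zero[of "F undefined"] M[of undefined] by linarith
  have cont: "continuous_on {0..} y"
    by (rule lipschitz_on_continuous_on[of M], rule lipschitz_onI) (use lip \<open>M \<ge> 0\<close> in \<open>auto simp: dist_norm dist_real_def\<close>)
  have Fcont: "continuous_on {0..} (\<lambda>s. F (y s))"
    using continuous_on_compose2[OF F cont] by simp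
  have eq: "y t = x + integral {0..t} (\<lambda>s. F (y s))" if t: "t \<ge> 0" for t
  proof -
    have L1: "(\<lambda>n. integral {0..t} (\<lambda>s. F (Y n s))) \<longlonglongrightarrow> integral {0..t} (\<lambda>s. F (y s))"
    proof (rule dominated_convergence(2))
      show "(\<lambda>s. F (Y n s)) integrable_on {0..t}" for n
        unfolding Y_def by (rule euler_step_integral(1)[OF M \<tau>pos t])
      show "(\<lambda>_. M) integrable_on {0..t}" by (rule integrable_const_ivl)
      show "norm (F (Y n s)) \<le> M" for n s by (rule M)
      show "(\<lambda>n. F (Y n s)) \<longlonglongrightarrow> F (y s)" if "s \<in> {0..t}" for s
        using continuous_on_tendsto_compose[OF F lim[of s]] that by simp
    qed
    have L2: "(\<lambda>n. Y n t - x - integral {0..t} (\<lambda>s. F (Y n s))) \<longlonglongrightarrow> 0"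
    proof (rule Lim_null_comparison)
      show "\<forall>\<^sub>F n in sequentially. norm (Y n t - x - integral {0..t} (\<lambda>s. F (Y n s))) \<le> M * \<tau> n"
        unfolding Y_def by (intro always_eventually allI euler_step_integral(2)[OF M \<tau>pos t])
      show "(\<lambda>n. M * \<tau> n) \<longlonglongrightarrow> 0" using \<tau>0 by (rule tendsto_mult_right_zero)
    qed
    have "(\<lambda>n. Y n t) \<longlonglongrightarrow> x + integral {0..t} (\<lambda>s. F (y s))"
      using tendsto_add[OF tendsto_add[OF L2 L1] tendsto_const[of x]]
      unfolding diff_add_cancel add_0_left by (simp only: add.commute[of "integral _ _" x])
    with lim[OF t] show ?thesis by (rule LIMSEQ_unique)
  qed
  have der: "(y has_vector_derivative F (y t)) (at t)" if t: "t > 0" for t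
  proof -
    have "continuous_on {0..t+1} (\<lambda>s. F (y s))" using Fcont by (rule continuous_on_subset) auto
    then have D: "((\<lambda>u. integral {0..u} (\<lambda>s. F (y s))) has_vector_derivative F (y t)) (at t within {0..t+1})"
      using integral_has_vector_derivative[of 0 "t+1" "\<lambda>s. F (y s)" t] t by simp
    have "((\<lambda>u. x + integral {0..u} (\<lambda>s. F (y s))) has_vector_derivative F (y t)) (at t within {0..t+1})"
      using has_vector_derivative_add[OF has_vector_derivative_const[of x] D] by simp
    then have "(y has_vector_derivative F (y t)) (at t within {0..t+1})"
      by (rule has_vector_derivative_transform[rotated 2]) (use t eq in simp_all)
    moreover have "at t within {0..t+1} = at t"
      using t by (intro at_within_interior) (simp add: interior_atLeastAtMost_real)
    ultimately show ?thesis by simp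
  qed
  show thesis by (rule that[OF y0 lip der])
qed

section \<open>Gradients and the Hamilton-Jacobi-Bellman equation\<close>

lemma norm_matrix_vector_mult_le:
  fixes A :: "real^'m^'n"
  shows "norm (A *v x) \<le> norm A * norm x"
proof -
  have "norm (A *v x) = L2_set (\<lambda>i. norm ((A *v x) $ i)) UNIV" by (simp add: norm_vec_def)
  also have "\<dots> \<le> L2_set (\<lambda>i. norm x * norm (A $ i)) UNIV"
    by (rule L2_set_mono) (simp_all add: matrix_vector_mul_component Cauchy_Schwarz_ineq2 mult.commute[of "norm x"])
  also have "\<dots> = norm x * norm A"
    by (simp add: norm_vec_def[of A] L2_set_right_distrib)
  finally show ?thesis by (simp add: mult.commute)
qed

lemma bounded_bilinear_matrix_vector_mult:
  "bounded_bilinear ((*v) :: real^'m^'n \<Rightarrow> real^'m \<Rightarrow> real^'n)"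
proof
  fix A B :: "real^'m^'n" and x y :: "real^'m" and r :: real
  show "(A + B) *v x = A *v x + B *v x" by (rule matrix_vector_mult_add_rdistrib)
  show "A *v (x + y) = A *v x + A *v y" by (rule matrix_vector_right_distrib)
  show "(r *\<^sub>R A) *v x = r *\<^sub>R (A *v x)"
    by (simp add: vec_eq_iff matrix_vector_mul_component)
  show "A *v (r *\<^sub>R x) = r *\<^sub>R (A *v x)"
    by (simp add: vec_eq_iff matrix_vector_mul_component)
  show "\<exists>K. \<forall>A x. norm ((A::real^'m^'n) *v x) \<le> norm A * norm x * K"
    by (intro exI[of _ 1] allI) (simp add: norm_matrix_vector_mult_le)
qed

lemmas continuous_on_matrix_vector_mult =
  bounded_bilinear.continuous_on[OF bounded_bilinear_matrix_vector_mult]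

lemma bounded_linear_transpose: "bounded_linear (transpose :: real^'m^'n \<Rightarrow> real^'n^'m)"
  unfolding linear_conv_bounded_linear[symmetric]
  by (rule linearI) (simp_all add: vec_eq_iff transpose_def)

lemma C1_on_continuous_on: "C1_on S F \<Longrightarrow> continuous_on S F"
  unfolding C1_on_def
  by (elim exE conjE, rule continuous_at_imp_continuous_on) (intro ballI, drule (1) bspec, rule has_derivative_continuous)

lemma C1_on_lipschitz_cball:
  assumes F: "C1_on S F" and sub: "cball z r \<subseteq> S"
  shows "\<exists>L\<ge>0. \<forall>x\<in>cball z r. \<forall>y\<in>cball z r. norm (F x - F y) \<le> L * norm (x - y)"
proof -
  obtain F' where F': "\<forall>x\<in>S. (F has_derivative blinfun_apply (F' x)) (at x)" "continuous_on S F'"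
    using F unfolding C1_on_def by (elim exE conjE)
  have "compact ((\<lambda>x. norm (F' x)) ` cball z r)"
    by (intro compact_continuous_image continuous_on_norm continuous_on_subset[OF F'(2) sub] compact_cball)
  then have "bounded ((\<lambda>x. norm (F' x)) ` cball z r)" by (rule compact_imp_bounded)
  then obtain B where nB: "\<forall>w\<in>(\<lambda>x. norm (F' x)) ` cball z r. norm w \<le> B" unfolding bounded_iff by (elim exE)
  then have B: "norm (F' x) \<le> B" if "x \<in> cball z r" for x
    using bspec[OF nB imageI[OF that, of "\<lambda>x. norm (F' x)"]] by simp
  show ?thesis
  proof (intro exI[of _ "max B 0"] conjI ballI)
    fix x y assume xy: "x \<in> cball z r" "y \<in> cball z r"
    show "norm (F x - F y) \<le> max B 0 * norm (x - y)"
    proof (rule differentiable_bound[of "cball z r" F "\<lambda>x. blinfun_apply (F' x)"])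
      show "(F has_derivative blinfun_apply (F' w)) (at w within cball z r)" if "w \<in> cball z r" for w
        by (rule has_derivative_at_withinI[OF bspec[OF F'(1) subsetD[OF sub that]]])
      show "onorm (blinfun_apply (F' w)) \<le> max B 0" if "w \<in> cball z r" for w
        using B[OF that] unfolding norm_blinfun.rep_eq[symmetric] by linarith
    qed (use xy in simp_all)
  qed simp
qed

lemma grad_eqI:
  assumes "GDERIV v x :> D"
  shows "grad v x = D"
  unfolding grad_def
proof (rule the_equality)
  show "GDERIV v x :> D" by (fact assms)
  fix E assume "GDERIV v x :> E"
  then have "(\<lambda>h. h \<bullet> E) = (\<lambda>h. h \<bullet> D)"
    using assms unfolding gderiv_def by (rule has_derivative_unique)
  then have "\<forall>h. h \<bullet> E = h \<bullet> D" by (rule fun_cong[THEN allI])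
  then show "E = D" by (simp add: vector_eq_ldot)
qed

text \<open>The gradient is assembled from the values of the derivative on the basis vectors; these
  depend continuously on the point because the derivative does so in operator norm.\<close>

lemma C1_on_grad:
  fixes v :: "'a::euclidean_space \<Rightarrow> real"
  assumes v: "C1_on S v"
  shows "\<And>x. x \<in> S \<Longrightarrow> (v has_derivative (\<lambda>h. h \<bullet> grad v x)) (at x)"
    and "continuous_on S (grad v)"
proof -
  obtain v' where v': "\<forall>x\<in>S. (v has_derivative blinfun_apply (v' x)) (at x)" "continuous_on S v'"
    using v unfolding C1_on_def by (elim exE conjE)
  define D where "D x = (\<Sum>b\<in>Basis. blinfun_apply (v' x) b *\<^sub>R b)" for x
  have D: "blinfun_apply (v' x) = (\<lambda>h. h \<bullet> D x)" for x
  proof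
    fix h
    have "blinfun_apply (v' x) h = blinfun_apply (v' x) (\<Sum>b\<in>Basis. (h \<bullet> b) *\<^sub>R b)"
      by (simp add: euclidean_representation)
    also have "\<dots> = (\<Sum>b\<in>Basis. (h \<bullet> b) * blinfun_apply (v' x) b)"
      by (simp add: blinfun.sum_right blinfun.scaleR_right)
    also have "\<dots> = h \<bullet> D x" unfolding D_def by (simp add: inner_sum_right mult.commute)
    finally show "blinfun_apply (v' x) h = h \<bullet> D x" .
  qed
  have g: "grad v x = D x" if "x \<in> S" for x
    using v'(1) that unfolding D by (intro grad_eqI) (simp add: gderiv_def)
  show "(v has_derivative (\<lambda>h. h \<bullet> grad v x)) (at x)" if "x \<in> S" for x
    using bspec[OF v'(1) that] unfolding g[OF that] D .
  have "continuous_on S D"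
    unfolding D_def by (intro continuous_intros v'(2))
  then show "continuous_on S (grad v)" by (rule continuous_on_eq) (simp add: g)
qed

text \<open>Positive definiteness makes the kernel trivial, which secures the inverse that
  \<open>matrix_inv\<close> selects by choice.\<close>

lemma sym_pos_def_inverse:
  assumes "sym_pos_def R"
  shows "R *v (matrix_inv R *v w) = w"
proof -
  have "x = 0" if "R *v x = 0" for x
  proof (rule ccontr)
    assume "x \<noteq> 0"
    then have "x \<bullet> (R *v x) > 0" using assms unfolding sym_pos_def_def by blast
    then show False using that by simp
  qed
  then have "\<exists>B. B ** R = mat 1" using matrix_left_invertible_ker by blast
  then obtain B where B: "B ** R = mat 1" by (elim exE)
  then have "R ** B = mat 1 \<and> B ** R = mat 1" by (simp add: matrix_left_right_inverse)
  then have "R ** matrix_inv R = mat 1 \<and> matrix_inv R ** R = mat 1" unfolding matrix_inv_def by (rule someI)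
  then show ?thesis by (simp add: matrix_vector_mul_assoc)
qed

lemma sym_pos_def_commute:
  assumes "sym_pos_def R"
  shows "x \<bullet> (R *v y) = y \<bullet> (R *v x)"
proof -
  have "y \<bullet> (R *v x) = (y v* R) \<bullet> x" by (rule dot_lmul_matrix[symmetric])
  also have "y v* R = transpose R *v y" by (rule transpose_matrix_vector[symmetric])
  also have "transpose R = R" using assms unfolding sym_pos_def_def by blast
  finally show ?thesis by (simp add: inner_commute)
qed

lemma sym_pos_def_nonneg: "sym_pos_def R \<Longrightarrow> x \<bullet> (R *v x) \<ge> 0"
  unfolding sym_pos_def_def by (cases "x = 0") (auto intro: less_imp_le)

text \<open>The feedback \<open>w\<close> satisfies
  \<open>R *v w = - (1/2) *\<^sub>R (transpose (g x) *v grad v x)\<close>, so the control enters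
  through \<open>- 2 * (u \<bullet> (R *v w))\<close>. The Hamilton-Jacobi-Bellman equation fixes
  the drift term as \<open>w \<bullet> (R *v w) - h x\<close>; together they leave the running cost
  and a square.\<close>

lemma hjb_complete_square:
  fixes g :: "real^'n \<Rightarrow> real^'m^'n"
  assumes R: "sym_pos_def R"
    and hjb: "(f x + g x *v feedback g R v x) \<bullet> grad v x + h x
                  + (weighted_norm R (feedback g R v x))\<^sup>2 = 0"
  shows "(f x + g x *v u) \<bullet> grad v x = - (h x + u \<bullet> (R *v u))
      + (u - feedback g R v x) \<bullet> (R *v (u - feedback g R v x))"
proof -
  define w p where "w = feedback g R v x" and "p = grad v x"
  have Rw: "R *v w = - (1/2) *\<^sub>R (transpose (g x) *v p)"
    unfolding w_def feedback_def p_def matrix_vector_mult_scaleR sym_pos_def_inverse[OF R] ..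
  have gp: "(g x *v z) \<bullet> p = - 2 * (z \<bullet> (R *v w))" for z
  proof -
    have "(g x *v z) \<bullet> p = (p v* g x) \<bullet> z" unfolding dot_lmul_matrix by (rule inner_commute)
    also have "\<dots> = - 2 * (z \<bullet> (R *v w))" unfolding Rw by (simp add: inner_commute)
    finally show ?thesis .
  qed
  have wn: "(weighted_norm R w)\<^sup>2 = w \<bullet> (R *v w)"
    unfolding weighted_norm_def using sym_pos_def_nonneg[OF R, of w] by simp
  have "(f x \<bullet> p + (g x *v w) \<bullet> p) + h x + w \<bullet> (R *v w) = 0"
    using hjb unfolding w_def[symmetric] p_def[symmetric] wn by (simp add: inner_add_left)
  then have fp: "f x \<bullet> p = w \<bullet> (R *v w) - h x" unfolding gp by simp
  have "(u - w) \<bullet> (R *v (u - w)) = u \<bullet> (R *v u) - 2 * (u \<bullet> (R *v w)) + w \<bullet> (R *v w)"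
    using sym_pos_def_commute[OF R, of w u]
    by (simp add: matrix_vector_mult_diff_distrib inner_diff_left inner_diff_right)
  then show ?thesis
    unfolding w_def[symmetric] p_def[symmetric] inner_add_left gp fp by simp
qed

text \<open>Parallelogram law: the difference of the two sides is the quadratic form at
  \<open>u + w\<close>.\<close>

lemma sym_pos_def_diff_le:
  assumes "sym_pos_def R"
  shows "(u - w) \<bullet> (R *v (u - w)) \<le> 2 * (u \<bullet> (R *v u)) + 2 * (w \<bullet> (R *v w))"
  using sym_pos_def_nonneg[OF assms, of "u + w"] sym_pos_def_commute[OF assms, of w u]
  by (simp add: matrix_vector_mult_diff_distrib matrix_vector_right_distrib
      inner_diff_left inner_diff_right inner_add_left inner_add_right)

lemma continuous_on_feedback:
  assumes "C1_on UNIV g" and "C1_on S v"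
  shows "continuous_on S (feedback g R v)"
proof -
  have "continuous_on S g" using C1_on_continuous_on[OF assms(1)] by (rule continuous_on_subset) simp
  then have gT: "continuous_on S (\<lambda>x. transpose (g x))"
    by (rule bounded_linear.continuous_on[OF bounded_linear_transpose])
  have "continuous_on S (\<lambda>x. - (1/2) *\<^sub>R (matrix_inv R *v (transpose (g x) *v grad v x)))"
    by (intro continuous_on_scaleR continuous_on_const
        continuous_on_matrix_vector_mult[OF continuous_on_const continuous_on_matrix_vector_mult[OF gT C1_on_grad(2)[OF assms(2)]]])
  then show ?thesis unfolding feedback_def .
qed

section \<open>Caratheodory solutions\<close>

lemma AE_lebesgue_iff_negligible:
  "(AE t in lebesgue. P t) \<longleftrightarrow> (\<exists>N. negligible N \<and> (\<forall>t. t \<notin> N \<longrightarrow> P (t::real)))"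
proof
  assume "AE t in lebesgue. P t"
  then obtain N where N: "N \<in> null_sets lebesgue" "{t \<in> space lebesgue. \<not> P t} \<subseteq> N"
    unfolding eventually_ae_filter by (elim bexE)
  have "\<forall>t. t \<notin> N \<longrightarrow> P t" using N(2) by (simp add: subset_eq) blast
  then show "\<exists>N. negligible N \<and> (\<forall>t. t \<notin> N \<longrightarrow> P t)"
    using N(1) by (intro exI[of _ N]) (simp add: negligible_iff_null_sets)
next
  assume "\<exists>N. negligible N \<and> (\<forall>t. t \<notin> N \<longrightarrow> P t)"
  then obtain N where N: "negligible N" "\<forall>t. t \<notin> N \<longrightarrow> P t" by (elim exE conjE)
  show "AE t in lebesgue. P t"
  proof (rule AE_I')
    show "N \<in> null_sets lebesgue" using N(1) by (simp add: negligible_iff_null_sets)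
    show "{t \<in> space lebesgue. \<not> P t} \<subseteq> N" using N(2) by blast
  qed
qed

text \<open>The caller only compares the derivative pointwise with an integrable \<open>k\<close>;
  integrability of the derivative itself comes from \<open>AC_has_integral\<close>.\<close>

lemma AC_diff_le:
  fixes \<phi> :: "real \<Rightarrow> real"
  assumes "a \<le> b" and ac: "abs_continuous_on_interval a b \<phi>" and N: "negligible N"
    and der: "\<And>t. t \<in> {a<..<b} - N \<Longrightarrow> \<exists>D. (\<phi> has_vector_derivative D) (at t) \<and> D \<le> k t"
    and k: "(k has_integral I) {a..b}"
  shows "\<phi> b - \<phi> a \<le> I"
proof -
  have "\<forall>t\<in>{a<..<b} - N. \<exists>D. (\<phi> has_vector_derivative D) (at t) \<and> D \<le> k t" using der by (rule ballI)
  from bchoice[OF this] obtain D where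
    D: "\<forall>t\<in>{a<..<b} - N. (\<phi> has_vector_derivative D t) (at t) \<and> D t \<le> k t" ..
  \<comment> \<open>At the exceptional points \<open>E\<close> is \<open>k\<close> itself, so
    \<open>E\<close> is at most \<open>k\<close> everywhere and the integrals can be
    compared.\<close>
  define E where "E t = (if t \<in> {a<..<b} - N then D t else k t)" for t
  have N': "negligible (N \<union> {a, b})" by (rule negligible_Un[OF N negligible_finite]) simp
  have "(\<phi> has_vector_derivative E t) (at t within {a..b})" if t: "t \<in> {a..b} - (N \<union> {a, b})" for t
  proof -
    have t': "t \<in> {a<..<b} - N" using t by auto
    then have "(\<phi> has_vector_derivative E t) (at t)" using D unfolding E_def by simp
    then show ?thesis by (rule has_vector_derivative_at_within)
  qed
  from AC_has_integral[OF \<open>a \<le> b\<close> ac N' this]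
  have "(E has_integral (\<phi> b - \<phi> a)) {a..b}" .
  then show ?thesis by (rule has_integral_le[OF _ k]) (use D in \<open>simp add: E_def\<close>)
qed

lemma AC_diff_ge:
  fixes \<phi> :: "real \<Rightarrow> real"
  assumes "a \<le> b" and ac: "abs_continuous_on_interval a b \<phi>" and N: "negligible N"
    and der: "\<And>t. t \<in> {a<..<b} - N \<Longrightarrow> \<exists>D. (\<phi> has_vector_derivative D) (at t) \<and> k t \<le> D"
    and k: "(k has_integral I) {a..b}"
  shows "I \<le> \<phi> b - \<phi> a"
proof -
  have ac': "abs_continuous_on_interval a b (\<lambda>t. - \<phi> t)"
    by (rule AC_dominated[OF ac ac, of 1 0]) simp_all
  have "\<exists>D. ((\<lambda>t. - \<phi> t) has_vector_derivative D) (at t) \<and> D \<le> - k t" if tN: "t \<in> {a<..<b} - N" for t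
  proof -
    obtain D where "(\<phi> has_vector_derivative D) (at t)" "k t \<le> D" using der[OF tN] by (elim exE conjE)
    then show ?thesis by (intro exI[of _ "- D"] conjI has_vector_derivative_minus) simp_all
  qed
  from AC_diff_le[OF \<open>a \<le> b\<close> ac' N this has_integral_neg[OF k]] show ?thesis by simp
qed

lemma AC_bounded:
  assumes "abs_continuous_on_interval a b p"
  shows "\<exists>B\<ge>0. \<forall>t\<in>{a..b}. norm (p t) \<le> B"
proof -
  have "compact (p ` {a..b})" by (rule compact_continuous_image[OF AC_continuous_on[OF assms] compact_Icc])
  then have "bounded (p ` {a..b})" by (rule compact_imp_bounded)
  then obtain B where B: "\<forall>w\<in>p ` {a..b}. norm w \<le> B" unfolding bounded_iff by (elim exE)
  have "norm (p t) \<le> max B 0" if "t \<in> {a..b}" for t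
    using bspec[OF B imageI[OF that]] by simp
  then show ?thesis by (intro exI[of _ "max B 0"]) simp
qed

text \<open>On the reals \<open>inner\<close> is multiplication, so this covers both the squared
  distance and its product with an exponential weight in the uniqueness proof.\<close>

lemma AC_inner:
  fixes p q :: "real \<Rightarrow> 'a::real_inner"
  assumes p: "abs_continuous_on_interval a b p" and q: "abs_continuous_on_interval a b q"
  shows "abs_continuous_on_interval a b (\<lambda>t. p t \<bullet> q t)"
proof -
  obtain P where P: "P \<ge> 0" "\<forall>t\<in>{a..b}. norm (p t) \<le> P" using AC_bounded[OF p] by (elim exE conjE)
  obtain Q where Q: "Q \<ge> 0" "\<forall>t\<in>{a..b}. norm (q t) \<le> Q" using AC_bounded[OF q] by (elim exE conjE)
  show ?thesis
  proof (rule AC_dominated[OF p q Q(1) P(1)])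
    fix s t assume st: "s \<in> {a..b}" "t \<in> {a..b}"
    have "p t \<bullet> q t - p s \<bullet> q s = (p t - p s) \<bullet> q t + p s \<bullet> (q t - q s)"
      by (simp add: inner_diff_left inner_diff_right)
    then have "norm (p t \<bullet> q t - p s \<bullet> q s) \<le> norm ((p t - p s) \<bullet> q t) + norm (p s \<bullet> (q t - q s))"
      by (simp only: norm_triangle_ineq)
    also have "norm ((p t - p s) \<bullet> q t) \<le> norm (p t - p s) * norm (q t)"
      by (simp add: Cauchy_Schwarz_ineq2)
    also have "norm (p s \<bullet> (q t - q s)) \<le> norm (p s) * norm (q t - q s)"
      by (simp add: Cauchy_Schwarz_ineq2)
    also have "norm (p t - p s) * norm (q t) \<le> norm (p t - p s) * Q"
      using Q(2) st by (intro mult_left_mono) simp_all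
    also have "norm (p s) * norm (q t - q s) \<le> P * norm (q t - q s)"
      using P(2) st by (intro mult_right_mono) simp_all
    finally show "norm (p t \<bullet> q t - p s \<bullet> q s) \<le> Q * norm (p t - p s) + P * norm (q t - q s)"
      by (simp add: mult.commute)
  qed
qed

lemma AC_exp:
  assumes "c \<ge> 0" "0 \<le> a"
  shows "abs_continuous_on_interval a b (\<lambda>t. exp (- c * t))"
proof (rule AC_lipschitz[OF \<open>c \<ge> 0\<close>])
  fix s t assume st: "s \<in> {a..b}" "t \<in> {a..b}"
  show "norm (exp (- c * t) - exp (- c * s)) \<le> c * \<bar>t - s\<bar>"
    unfolding real_norm_def[of "t - s", symmetric]
  proof (rule differentiable_bound[of "{a..b}" "\<lambda>t. exp (- c * t)" "\<lambda>t h. h * (- c * exp (- c * t))"])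
    fix r assume r: "r \<in> {a..b}"
    show "((\<lambda>t. exp (- c * t)) has_derivative (\<lambda>h. h * (- c * exp (- c * r)))) (at r within {a..b})"
      by (auto intro!: derivative_eq_intros)
    show "onorm (\<lambda>h. h * (- c * exp (- c * r))) \<le> c"
    proof (rule onorm_le)
      fix h :: real
      have "exp (- c * r) \<le> 1" using r assms by simp
      then have "\<bar>h\<bar> * c * exp (- c * r) \<le> \<bar>h\<bar> * c * 1" using assms by (intro mult_left_mono) simp_all
      then show "norm (h * (- c * exp (- c * r))) \<le> c * norm h"
        using assms by (simp add: abs_mult mult_ac)
    qed
  qed (use st in simp_all)
qed

text \<open>A finite-horizon form with an explicit null set, ready for the comparison lemmas.
  Restricting to the open interval lets solutions that agree on \<open>{0..b}\<close> be exchanged,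
  as two-sided derivatives there see no values outside.\<close>

definition solves_on ::
  "(real^'n \<Rightarrow> real^'n) \<Rightarrow> (real^'n \<Rightarrow> real^'m^'n) \<Rightarrow> (real \<Rightarrow> real^'m) \<Rightarrow> real \<Rightarrow> (real \<Rightarrow> real^'n) \<Rightarrow> bool" where
  "solves_on f g u b y \<longleftrightarrow> abs_continuous_on_interval 0 b y \<and>
     (\<exists>N. negligible N \<and> (\<forall>t\<in>{0<..<b} - N. (y has_vector_derivative (f (y t) + g (y t) *v u t)) (at t)))"

lemma solves_on_subset:
  assumes "solves_on f g u b y" "c \<le> b"
  shows "solves_on f g u c y"
proof -
  obtain N where N: "negligible N"
    "\<forall>t\<in>{0<..<b} - N. (y has_vector_derivative (f (y t) + g (y t) *v u t)) (at t)"
    and ac: "abs_continuous_on_interval 0 b y"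
    using assms(1) unfolding solves_on_def by (elim conjE exE)
  have "abs_continuous_on_interval 0 c y" by (rule AC_subset[OF ac]) (use assms(2) in simp)
  moreover have "\<forall>t\<in>{0<..<c} - N. (y has_vector_derivative (f (y t) + g (y t) *v u t)) (at t)"
    using N(2) assms(2) by simp
  ultimately show ?thesis unfolding solves_on_def using N(1) by blast
qed

lemma caratheodory_solves_on:
  assumes "caratheodory_solution f g u x T y" "0 \<le> b" "ereal b < T"
  shows "solves_on f g u b y" "y 0 = x"
proof -
  have ac: "abs_continuous_on_interval 0 b y"
    and ae: "AE t in lebesgue. 0 < t \<and> ereal t < T \<longrightarrow> (y has_vector_derivative (f (y t) + g (y t) *v u t)) (at t)"
    and y0: "y 0 = x"
    using assms unfolding caratheodory_solution_def by simp_all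
  show "y 0 = x" by fact
  obtain N where N: "negligible N"
    "\<forall>t. t \<notin> N \<longrightarrow> 0 < t \<and> ereal t < T \<longrightarrow> (y has_vector_derivative (f (y t) + g (y t) *v u t)) (at t)"
    using ae unfolding AE_lebesgue_iff_negligible by (elim exE conjE)
  have "(y has_vector_derivative (f (y t) + g (y t) *v u t)) (at t)" if t: "t \<in> {0<..<b} - N" for t
  proof -
    have "ereal t < ereal b" using t by simp
    then have "ereal t < T" using assms(3) by (rule less_trans)
    then show ?thesis using N(2) t by simp
  qed
  then show "solves_on f g u b y" unfolding solves_on_def using ac N(1) by blast
qed

text \<open>The exceptional sets may change with the horizon; those of the integer horizons have a
  negligible union.\<close>

lemma caratheodory_solution_infinity:
  assumes y0: "y 0 = x" and sol: "\<And>b. b \<ge> 0 \<Longrightarrow> solves_on f g u b y"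
  shows "caratheodory_solution f g u x \<infinity> y"
proof -
  have "\<forall>n::nat. \<exists>N. negligible N \<and>
      (\<forall>t\<in>{0<..<real n} - N. (y has_vector_derivative (f (y t) + g (y t) *v u t)) (at t))"
    using sol[of "real _"] unfolding solves_on_def by simp
  from choice[OF this] obtain N where N: "\<forall>n::nat. negligible (N n) \<and>
      (\<forall>t\<in>{0<..<real n} - N n. (y has_vector_derivative (f (y t) + g (y t) *v u t)) (at t))" ..
  have neg: "negligible (\<Union>n. N n)" using N by (intro negligible_countable_Union) auto
  have der: "(y has_vector_derivative (f (y t) + g (y t) *v u t)) (at t)" if "t \<notin> (\<Union>n. N n)" "0 < t" for t
  proof -
    obtain n :: nat where "t < real n" using reals_Archimedean2 by blast
    then have "t \<in> {0<..<real n} - N n" using that by simp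
    then show ?thesis using N by blast
  qed
  have "AE t in lebesgue. 0 < t \<and> ereal t < \<infinity> \<longrightarrow> (y has_vector_derivative (f (y t) + g (y t) *v u t)) (at t)"
    unfolding AE_lebesgue_iff_negligible using neg der by blast
  moreover have "\<forall>b\<ge>0. ereal b < \<infinity> \<longrightarrow> abs_continuous_on_interval 0 b y"
    using sol unfolding solves_on_def by simp
  ultimately show ?thesis unfolding caratheodory_solution_def using y0 by simp
qed

lemma Linf_controls_iff:
  "u \<in> Linf_controls \<longleftrightarrow> u \<in> borel_measurable (lebesgue_on {0..}) \<and>
     (\<exists>C\<ge>0. \<exists>N. negligible N \<and> (\<forall>t\<ge>0. t \<notin> N \<longrightarrow> norm (u t) \<le> C))"
proof -
  have ae: "(AE t in lebesgue_on {0..}. norm (u t) \<le> C) \<longleftrightarrow>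
      (\<exists>N. negligible N \<and> (\<forall>t\<ge>0. t \<notin> N \<longrightarrow> norm (u t) \<le> C))" for C
    by (subst AE_restrict_space_iff) (auto simp: AE_lebesgue_iff_negligible)
  have "(\<exists>C. \<exists>N. negligible N \<and> (\<forall>t\<ge>0. t \<notin> N \<longrightarrow> norm (u t) \<le> C)) \<longleftrightarrow>
     (\<exists>C\<ge>0. \<exists>N. negligible N \<and> (\<forall>t\<ge>0. t \<notin> N \<longrightarrow> norm (u t) \<le> C))"
  proof
    assume "\<exists>C. \<exists>N. negligible N \<and> (\<forall>t\<ge>0. t \<notin> N \<longrightarrow> norm (u t) \<le> C)"
    then obtain C N where CN: "negligible N" "\<forall>t\<ge>0. t \<notin> N \<longrightarrow> norm (u t) \<le> C" by (elim exE conjE)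
    then have "\<forall>t\<ge>0. t \<notin> N \<longrightarrow> norm (u t) \<le> max C 0" by (simp add: le_max_iff_disj)
    then show "\<exists>C\<ge>0. \<exists>N. negligible N \<and> (\<forall>t\<ge>0. t \<notin> N \<longrightarrow> norm (u t) \<le> C)"
      using CN(1) by (intro exI[of _ "max C 0"] conjI exI[of _ N]) simp_all
  qed blast
  then show ?thesis unfolding Linf_controls_def mem_Collect_eq ae by simp
qed

text \<open>Gronwall: both trajectories lie in a ball on which \<open>f\<close> and \<open>g\<close>
  are Lipschitz, and \<open>u\<close> is essentially bounded, so the right-hand sides differ by at
  most \<open>L\<close> times the distance. The squared distance weighted with
  \<open>exp (- (2 * L) * t)\<close> therefore cannot increase.\<close>

lemma solves_on_unique:
  assumes f: "C1_on UNIV f" and g: "C1_on UNIV g" and u: "u \<in> Linf_controls" and b: "0 \<le> b"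
    and y1: "solves_on f g u b y1" and y2: "solves_on f g u b y2" and init: "y1 0 = y2 0"
  shows "y1 b = y2 b"
proof -
  obtain C N0 where C: "C \<ge> 0" "negligible N0" "\<forall>t\<ge>0. t \<notin> N0 \<longrightarrow> norm (u t) \<le> C"
    using u unfolding Linf_controls_iff by (elim conjE exE)
  obtain N1 where N1: "negligible N1"
    "\<forall>t\<in>{0<..<b} - N1. (y1 has_vector_derivative (f (y1 t) + g (y1 t) *v u t)) (at t)"
    and ac1: "abs_continuous_on_interval 0 b y1"
    using y1 unfolding solves_on_def by (elim conjE exE)
  obtain N2 where N2: "negligible N2"
    "\<forall>t\<in>{0<..<b} - N2. (y2 has_vector_derivative (f (y2 t) + g (y2 t) *v u t)) (at t)"
    and ac2: "abs_continuous_on_interval 0 b y2"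
    using y2 unfolding solves_on_def by (elim conjE exE)
  obtain B1 where B1: "B1 \<ge> 0" "\<forall>t\<in>{0..b}. norm (y1 t) \<le> B1" using AC_bounded[OF ac1] by (elim exE conjE)
  obtain B2 where B2: "B2 \<ge> 0" "\<forall>t\<in>{0..b}. norm (y2 t) \<le> B2" using AC_bounded[OF ac2] by (elim exE conjE)
  define r where "r = max B1 B2"
  have r: "y1 t \<in> cball 0 r" "y2 t \<in> cball 0 r" if "t \<in> {0..b}" for t
    using B1(2) B2(2) that unfolding r_def by (auto simp: le_max_iff_disj)
  obtain Lf where Lf: "Lf \<ge> 0" "\<forall>x\<in>cball 0 r. \<forall>y\<in>cball 0 r. norm (f x - f y) \<le> Lf * norm (x - y)"
    using C1_on_lipschitz_cball[OF f, of 0 r] by auto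
  obtain Lg where Lg: "Lg \<ge> 0" "\<forall>x\<in>cball 0 r. \<forall>y\<in>cball 0 r. norm (g x - g y) \<le> Lg * norm (x - y)"
    using C1_on_lipschitz_cball[OF g, of 0 r] by auto
  define L where "L = Lf + Lg * C"
  have L: "L \<ge> 0" unfolding L_def using Lf(1) Lg(1) C(1) by simp
  define z where "z t = y1 t - y2 t" for t
  define \<phi> where "\<phi> t = exp (- (2 * L) * t) \<bullet> (z t \<bullet> z t)" for t
  have acz: "abs_continuous_on_interval 0 b z"
  proof (rule AC_dominated[OF ac1 ac2, of 1 1])
    fix s t
    show "norm (z t - z s) \<le> 1 * norm (y1 t - y1 s) + 1 * norm (y2 t - y2 s)"
      unfolding z_def using norm_triangle_ineq4[of "y1 t - y1 s" "y2 t - y2 s"] by (simp add: algebra_simps)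
  qed simp_all
  have ac: "abs_continuous_on_interval 0 b \<phi>"
    unfolding \<phi>_def using L by (intro AC_inner AC_exp acz) simp_all
  have "\<phi> b - \<phi> 0 \<le> 0"
  proof (rule AC_diff_le[OF b ac])
    show "negligible (N0 \<union> N1 \<union> N2)" using C(2) N1(1) N2(1) by simp
    show "((\<lambda>_. 0) has_integral 0) {0..b}" by simp
    fix t assume t: "t \<in> {0<..<b} - (N0 \<union> N1 \<union> N2)"
    define D where "D = (f (y1 t) + g (y1 t) *v u t) - (f (y2 t) + g (y2 t) *v u t)"
    define e where "e = exp (- (2 * L) * t)"
    have tb: "t \<in> {0..b}" using t by simp
    have ut: "norm (u t) \<le> C" using C(3) t by simp
    have zD: "(z has_vector_derivative D) (at t)"
      unfolding z_def D_def using N1(2) N2(2) t by (intro has_vector_derivative_diff) simp_all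
    have Deq: "D = (f (y1 t) - f (y2 t)) + (g (y1 t) - g (y2 t)) *v u t"
      unfolding D_def by (simp add: matrix_vector_mult_diff_rdistrib)
    have "norm ((g (y1 t) - g (y2 t)) *v u t) \<le> norm (g (y1 t) - g (y2 t)) * norm (u t)"
      by (rule norm_matrix_vector_mult_le)
    also have "\<dots> \<le> (Lg * norm (z t)) * C"
      using Lg r[OF tb] ut unfolding z_def by (intro mult_mono) simp_all
    finally have "norm D \<le> Lf * norm (z t) + (Lg * norm (z t)) * C"
      unfolding Deq using Lf(2) r[OF tb] unfolding z_def
      by (intro order_trans[OF norm_triangle_ineq] add_mono) simp_all
    also have "\<dots> = L * norm (z t)" unfolding L_def by (simp add: algebra_simps)
    finally have "norm (z t) * norm D \<le> norm (z t) * (L * norm (z t))" by (intro mult_left_mono) simp_all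
    moreover have "z t \<bullet> D \<le> norm (z t) * norm D" by (rule norm_cauchy_schwarz)
    ultimately have zDle: "z t \<bullet> D \<le> L * (z t \<bullet> z t)"
      by (simp add: power2_norm_eq_inner[symmetric] power2_eq_square mult_ac)
    have "((\<lambda>t. exp (- (2 * L) * t)) has_vector_derivative (- (2 * L) * e)) (at t)"
      unfolding e_def has_real_derivative_iff_has_vector_derivative[symmetric]
      by (auto intro!: derivative_eq_intros)
    moreover have "((\<lambda>t. z t \<bullet> z t) has_vector_derivative (z t \<bullet> D + D \<bullet> z t)) (at t)"
      by (rule bounded_bilinear.has_vector_derivative[OF bounded_bilinear_inner zD zD])
    ultimately have "(\<phi> has_vector_derivative (e \<bullet> (z t \<bullet> D + D \<bullet> z t) + (- (2 * L) * e) \<bullet> (z t \<bullet> z t))) (at t)"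
      unfolding \<phi>_def e_def by (rule bounded_bilinear.has_vector_derivative[OF bounded_bilinear_inner])
    also have "e \<bullet> (z t \<bullet> D + D \<bullet> z t) + (- (2 * L) * e) \<bullet> (z t \<bullet> z t) = (2 * e) * (z t \<bullet> D - L * (z t \<bullet> z t))"
      by (simp add: inner_commute[of D] algebra_simps)
    finally have d\<phi>: "(\<phi> has_vector_derivative (2 * e) * (z t \<bullet> D - L * (z t \<bullet> z t))) (at t)" .
    have "(2 * e) * (z t \<bullet> D - L * (z t \<bullet> z t)) \<le> 0"
      using zDle unfolding e_def by (intro mult_nonneg_nonpos) simp_all
    with d\<phi> show "\<exists>D. (\<phi> has_vector_derivative D) (at t) \<and> D \<le> 0" by (intro exI conjI)
  qed
  moreover have "\<phi> 0 = 0" unfolding \<phi>_def z_def using init by simp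
  ultimately have "exp (- (2 * L) * b) * (z b \<bullet> z b) \<le> 0" unfolding \<phi>_def by simp
  then have "z b \<bullet> z b \<le> 0" by (simp add: mult_le_0_iff)
  then have "z b = 0" using inner_ge_zero[of "z b"] by (simp add: order_antisym)
  then show ?thesis unfolding z_def by simp
qed

section \<open>The cost functional and dynamic programming\<close>

text \<open>Uniqueness makes the definite description refer to whatever solution is at hand.\<close>

lemma trajectory_eq:
  assumes f: "C1_on UNIV f" and g: "C1_on UNIV g" and u: "u \<in> Linf_controls"
    and y: "caratheodory_solution f g u x T y" and t: "0 \<le> t" "ereal t < T"
  shows "trajectory f g u x t = y t"
  unfolding trajectory_def
proof (rule the_equality)
  show "\<exists>T y'. caratheodory_solution f g u x T y' \<and> ereal t < T \<and> y t = y' t" using y t(2) by blast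
next
  fix z assume "\<exists>T y. caratheodory_solution f g u x T y \<and> ereal t < T \<and> z = y t"
  then obtain T' y' where y': "caratheodory_solution f g u x T' y'" "ereal t < T'" "z = y' t" by (elim exE conjE)
  have "y' t = y t"
    by (rule solves_on_unique[OF f g u t(1) caratheodory_solves_on(1)[OF y'(1) t(1) y'(2)]
          caratheodory_solves_on(1)[OF y t]])
      (simp add: caratheodory_solves_on(2)[OF y'(1) t(1) y'(2)] caratheodory_solves_on(2)[OF y t])
  with y'(3) show "z = y t" by simp
qed

text \<open>An infinite supremum of horizons supplies a possibly different solution for each
  \<open>b\<close>. By uniqueness each agrees with the trajectory, which thus inherits absolute
  continuity and, on open intervals, the derivatives.\<close>

lemma caratheodory_solution_trajectory:
  assumes f: "C1_on UNIV f" and g: "C1_on UNIV g" and u: "u \<in> Linf_controls"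
    and esc: "escape_time f g u x = \<infinity>"
  shows "caratheodory_solution f g u x \<infinity> (trajectory f g u x)"
proof -
  define y where "y = trajectory f g u x"
  have ex: "\<exists>z. solves_on f g u (b + 1) z \<and> z 0 = x \<and> (\<forall>t\<in>{0..b + 1}. y t = z t)" if b: "0 \<le> b" for b
  proof -
    have "ereal (b + 1) < Sup {T. \<exists>y. caratheodory_solution f g u x T y}"
      using esc unfolding escape_time_def by simp
    then obtain T z where z: "caratheodory_solution f g u x T z" and T: "ereal (b + 1) < T"
      unfolding less_Sup_iff by (elim bexE CollectE exE)
    have "y t = z t" if "t \<in> {0..b + 1}" for t
    proof -
      have "ereal t \<le> ereal (b + 1)" using that by simp
      then have "ereal t < T" using T by (rule le_less_trans)
      then show ?thesis unfolding y_def using that by (intro trajectory_eq[OF f g u z]) simp_all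
    qed
    moreover have "0 \<le> b + 1" using b by simp
    ultimately show ?thesis using caratheodory_solves_on[OF z _ T] by (intro exI[of _ z]) simp
  qed
  have y0: "y 0 = x"
  proof -
    obtain z where "z 0 = x" "\<forall>t\<in>{0..0 + 1}. y t = z t" using ex[of 0] by auto
    then show ?thesis by simp
  qed
  have "solves_on f g u b y" if b: "b \<ge> 0" for b
  proof -
    obtain z where z: "solves_on f g u (b + 1) z" and eq: "\<forall>t\<in>{0..b + 1}. y t = z t"
      using ex[OF b] by (elim exE conjE)
    have "solves_on f g u b z" by (rule solves_on_subset[OF z]) simp
    then obtain N where N: "negligible N"
      "\<forall>t\<in>{0<..<b} - N. (z has_vector_derivative (f (z t) + g (z t) *v u t)) (at t)"
      and ac: "abs_continuous_on_interval 0 b z"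
      unfolding solves_on_def by (elim conjE exE)
    have "abs_continuous_on_interval 0 b y"
      by (rule AC_dominated[OF ac ac, of 1 0]) (use eq in simp_all)
    moreover have "(y has_vector_derivative (f (y t) + g (y t) *v u t)) (at t)" if t: "t \<in> {0<..<b} - N" for t
    proof -
      have "y t = z t" using eq t by simp
      moreover have "(z has_vector_derivative (f (z t) + g (z t) *v u t)) (at t)" using N(2) t by blast
      then have "(y has_vector_derivative (f (z t) + g (z t) *v u t)) (at t)"
        by (rule has_vector_derivative_transform_within_open[of _ _ _ "{0<..<b}"]) (use eq t in simp_all)
      ultimately show ?thesis by simp
    qed
    ultimately show ?thesis unfolding solves_on_def using N(1) by blast
  qed
  with y0 show ?thesis unfolding y_def by (intro caratheodory_solution_infinity) simp_all
qed

section \<open>Running cost: measurability and integrability\<close>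

definition running_cost :: "(real^'n \<Rightarrow> real) \<Rightarrow> real^'m^'m \<Rightarrow> (real \<Rightarrow> real^'n) \<Rightarrow> (real \<Rightarrow> real^'m) \<Rightarrow> real \<Rightarrow> real" where
  "running_cost h R y u t = h (y t) + u t \<bullet> (R *v u t)"

lemma solves_on_continuous_on:
  assumes "\<And>b. b \<ge> 0 \<Longrightarrow> solves_on f g u b y"
  shows "continuous_on {0..} y"
  unfolding continuous_on_iff
proof (intro ballI allI impI)
  fix t e :: real assume t: "t \<in> {0..}" and e: "0 < e"
  have "abs_continuous_on_interval 0 (t + 1) y" using assms[of "t + 1"] t unfolding solves_on_def by simp
  then have "continuous_on {0..t + 1} y" by (rule AC_continuous_on)
  moreover have "t \<in> {0..t + 1}" using t by simp
  ultimately have "\<exists>d>0. \<forall>s\<in>{0..t + 1}. dist s t < d \<longrightarrow> dist (y s) (y t) < e"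
    using e unfolding continuous_on_iff by blast
  then obtain d where d: "d > 0" "\<forall>s\<in>{0..t + 1}. dist s t < d \<longrightarrow> dist (y s) (y t) < e" by (elim exE conjE)
  show "\<exists>d>0. \<forall>s\<in>{0..}. dist s t < d \<longrightarrow> dist (y s) (y t) < e"
  proof (intro exI[of _ "min d 1"] conjI ballI impI)
    show "min d 1 > 0" using d(1) by simp
    fix s assume s: "s \<in> {0..}" "dist s t < min d 1"
    then have "s \<in> {0..t + 1}" by (simp add: dist_real_def abs_less_iff)
    then show "dist (y s) (y t) < e" using d(2) s(2) by simp
  qed
qed

lemma running_cost_measurable:
  assumes h: "continuous_on UNIV h" and u: "u \<in> Linf_controls" and y: "continuous_on {0..} y"
  shows "running_cost h R y u \<in> borel_measurable (lebesgue_on {0..})"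
proof -
  have "continuous_on {0..} (\<lambda>t. h (y t))" using continuous_on_compose2[OF h y] by simp
  then have "(\<lambda>t. h (y t)) \<in> borel_measurable (lebesgue_on {0..})"
    by (rule continuous_imp_measurable_on_sets_lebesgue) simp
  moreover have "continuous_on UNIV (\<lambda>w::real^'b. w \<bullet> (R *v w))"
    by (intro continuous_on_inner continuous_on_matrix_vector_mult continuous_on_const continuous_on_id)
  then have "(\<lambda>w::real^'b. w \<bullet> (R *v w)) \<in> borel_measurable borel" by (rule borel_measurable_continuous_onI)
  then have "(\<lambda>t. u t \<bullet> (R *v u t)) \<in> borel_measurable (lebesgue_on {0..})"
    using u unfolding Linf_controls_iff by (elim conjE) (rule measurable_compose)
  ultimately show ?thesis unfolding running_cost_def by (rule borel_measurable_add)
qed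

lemma running_cost_integrable:
  assumes h: "continuous_on UNIV h" and u: "u \<in> Linf_controls" and y: "continuous_on {0..} y"
  shows "running_cost h R y u integrable_on {0..b}"
proof -
  obtain C N where C: "C \<ge> 0" "negligible N" "\<forall>t\<ge>0. t \<notin> N \<longrightarrow> norm (u t) \<le> C"
    using u unfolding Linf_controls_iff by (elim conjE exE)
  have "continuous_on {0..b} y" using y by (rule continuous_on_subset) auto
  then have "continuous_on {0..b} (\<lambda>t. h (y t))" using continuous_on_compose2[OF h] by blast
  then have "bounded ((\<lambda>t. h (y t)) ` {0..b})" using compact_continuous_image compact_imp_bounded compact_Icc by blast
  then obtain H where H0: "\<forall>w\<in>(\<lambda>t. h (y t)) ` {0..b}. norm w \<le> H" unfolding bounded_iff by (elim exE)
  define B where "B = max H 0 + norm R * C\<^sup>2"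
  have "B \<ge> 0" unfolding B_def by simp
  \<comment> \<open>The control is bounded only almost everywhere. Cutting the running cost off at
    \<open>B\<close> yields a function bounded everywhere that agrees with it on
    \<open>{0..b} - N\<close>.\<close>
  define l where "l t = (if \<bar>running_cost h R y u t\<bar> \<le> B then running_cost h R y u t else 0)" for t
  have bnd: "\<bar>running_cost h R y u t\<bar> \<le> B" if t: "t \<in> {0..b} - N" for t
  proof -
    have "norm (h (y t)) \<le> H" using bspec[OF H0 imageI, of t] t by simp
    moreover have "\<bar>u t \<bullet> (R *v u t)\<bar> \<le> norm (u t) * norm (R *v u t)" by (rule Cauchy_Schwarz_ineq2)
    moreover have "norm (u t) * norm (R *v u t) \<le> norm (u t) * (norm R * norm (u t))"
      by (intro mult_left_mono norm_matrix_vector_mult_le) simp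
    moreover have "norm (u t) * (norm R * norm (u t)) \<le> C * (norm R * C)"
      using C t by (intro mult_mono) simp_all
    ultimately show ?thesis unfolding running_cost_def B_def power2_eq_square by (simp add: mult_ac)
  qed
  have m: "running_cost h R y u \<in> borel_measurable (lebesgue_on {0..b})"
    by (rule measurable_restrict_mono[OF running_cost_measurable[OF h u y]]) auto
  have "l \<in> borel_measurable (lebesgue_on {0..b})"
    unfolding l_def using m by measurable
  then have "l absolutely_integrable_on {0..b}"
    by (rule measurable_bounded_by_integrable_imp_absolutely_integrable[where g = "\<lambda>_. B"])
      (use \<open>B \<ge> 0\<close> in \<open>simp_all add: l_def integrable_const_ivl\<close>)
  then have "l integrable_on {0..b}" by (rule set_lebesgue_integral_eq_integral(1))
  then show ?thesis by (rule integrable_spike[OF _ C(2)]) (use bnd in \<open>simp add: l_def\<close>)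
qed

locale control_problem =
  fixes f :: "real^'n \<Rightarrow> real^'n" and g :: "real^'n \<Rightarrow> real^'m^'n"
    and h :: "real^'n \<Rightarrow> real" and R :: "real^'m^'m"
  assumes data: "standing_assumptions f g h R"
begin

lemma C1_f: "C1_on UNIV f" and C1_g: "C1_on UNIV g" and R: "sym_pos_def R"
  and h0: "h 0 = 0" and h_pos: "x \<noteq> 0 \<Longrightarrow> h x > 0" and cont_h: "continuous_on UNIV h"
  using data C1_on_continuous_on[of UNIV h] unfolding standing_assumptions_def by simp_all

lemma h_nonneg: "h x \<ge> 0"
  using h_pos[of x] h0 by (cases "x = 0") simp_all

lemma running_cost_nonneg: "running_cost h R y u t \<ge> 0"
  unfolding running_cost_def using h_nonneg sym_pos_def_nonneg[OF R] by (rule add_nonneg_nonneg)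

text \<open>Ties a control to any concrete solution, such as one produced by Peano's theorem, in
  place of the definite description in \<open>trajectory\<close>.\<close>

definition global_solution :: "(real \<Rightarrow> real^'m) \<Rightarrow> real^'n \<Rightarrow> (real \<Rightarrow> real^'n) \<Rightarrow> bool" where
  "global_solution u x y \<longleftrightarrow> u \<in> Linf_controls \<and> y 0 = x \<and> (\<forall>b\<ge>0. solves_on f g u b y)"

lemma global_solution_continuous: "global_solution u x y \<Longrightarrow> continuous_on {0..} y"
  unfolding global_solution_def using solves_on_continuous_on by blast

lemma global_solution_cost:
  assumes "global_solution u x y"
  shows "cost f g h R x u = (\<integral>\<^sup>+t. ennreal (running_cost h R y u t) * indicator {0..} t \<partial>lebesgue)"
proof -
  have u: "u \<in> Linf_controls" and y0: "y 0 = x" and sol: "\<And>b. b \<ge> 0 \<Longrightarrow> solves_on f g u b y"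
    using assms unfolding global_solution_def by simp_all
  have y: "caratheodory_solution f g u x \<infinity> y" by (rule caratheodory_solution_infinity[OF y0 sol])
  then have "\<infinity> \<le> escape_time f g u x" unfolding escape_time_def by (intro Sup_upper) blast
  then have "escape_time f g u x = \<infinity>" by simp
  moreover have "trajectory f g u x t = y t" if "0 \<le> t" for t
    using trajectory_eq[OF C1_f C1_g u y that] by simp
  ultimately show ?thesis
    unfolding cost_def running_cost_def by (auto intro!: nn_integral_cong split: split_indicator)
qed

lemma cost_finite_global_solution:
  assumes "u \<in> Linf_controls" "cost f g h R x u \<noteq> \<infinity>"
  shows "\<exists>y. global_solution u x y"
proof -
  have esc: "escape_time f g u x = \<infinity>" using assms(2) unfolding cost_def by (simp split: if_splits)
  have y: "caratheodory_solution f g u x \<infinity> (trajectory f g u x)"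
    by (rule caratheodory_solution_trajectory[OF C1_f C1_g assms(1) esc])
  have "global_solution u x (trajectory f g u x)"
    unfolding global_solution_def
    using caratheodory_solves_on(1)[OF y] caratheodory_solves_on(2)[OF y order_refl] assms(1) by simp
  then show ?thesis by (intro exI[of _ "trajectory f g u x"])
qed

lemma global_solution_integrable:
  "global_solution u x y \<Longrightarrow> running_cost h R y u integrable_on {0..b}"
  using running_cost_integrable[OF cont_h _ global_solution_continuous]
  unfolding global_solution_def by blast

lemma integral_nn_integral:
  assumes "global_solution u x y"
  shows "(\<integral>\<^sup>+t. ennreal (running_cost h R y u t) * indicator {0..b} t \<partial>lebesgue)
    = ennreal (integral {0..b} (running_cost h R y u))"
  unfolding nn_integral_completion
  by (rule nn_integral_has_integral_lebesgue'[OF running_cost_nonneg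
        integrable_integral[OF global_solution_integrable[OF assms]]])

lemma integral_le_cost:
  assumes "global_solution u x y"
  shows "ennreal (integral {0..b} (running_cost h R y u)) \<le> cost f g h R x u"
  unfolding integral_nn_integral[OF assms, symmetric] global_solution_cost[OF assms]
  by (intro nn_integral_mono mult_left_mono) (auto split: split_indicator)

lemma nn_measurable:
  assumes "global_solution u x y"
  shows "(\<lambda>t. ennreal (running_cost h R y u t) * indicator {0..} t) \<in> borel_measurable lebesgue"
proof -
  have "running_cost h R y u \<in> borel_measurable (lebesgue_on {0..})"
    using running_cost_measurable[OF cont_h _ global_solution_continuous[OF assms]] assms
    unfolding global_solution_def by blast
  then have "(\<lambda>t. ennreal (running_cost h R y u t)) \<in> borel_measurable (lebesgue_on {0..})" by measurable
  then show ?thesis by (subst (asm) borel_measurable_restrict_space_iff_ennreal) simp_all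
qed

lemma cost_le:
  assumes y: "global_solution u x y"
    and le: "\<And>b. b \<ge> 0 \<Longrightarrow> integral {0..b} (running_cost h R y u) \<le> c"
  shows "cost f g h R x u \<le> ennreal c"
proof -
  \<comment> \<open>The factor \<open>indicator {0..} t\<close> exhibits each \<open>F n\<close> as
    a product of functions known to be measurable; the next equation gives the form whose integral
    is known.\<close>
  define F where "F n t = ennreal (running_cost h R y u t) * indicator {0..} t * indicator {0..real n} t" for n t
  have F: "F n t = ennreal (running_cost h R y u t) * indicator {0..real n} t" for n t
    unfolding F_def by (auto split: split_indicator)
  have "cost f g h R x u \<le> (\<integral>\<^sup>+t. (SUP n. F n t) \<partial>lebesgue)"
    unfolding global_solution_cost[OF y]
  proof (rule nn_integral_mono)
    fix t :: real
    obtain n :: nat where n: "t \<le> real n" using real_arch_simple by blast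
    have "ennreal (running_cost h R y u t) * indicator {0..} t \<le> F n t"
      using n unfolding F by (auto split: split_indicator)
    also have "\<dots> \<le> (SUP n. F n t)" by (rule SUP_upper) simp
    finally show "ennreal (running_cost h R y u t) * indicator {0..} t \<le> (SUP n. F n t)" .
  qed
  also have "\<dots> = (SUP n. \<integral>\<^sup>+t. F n t \<partial>lebesgue)"
  proof (rule nn_integral_monotone_convergence_SUP)
    show "incseq F"
      unfolding F incseq_def le_fun_def by (auto split: split_indicator)
    show "F n \<in> borel_measurable lebesgue" for n
      unfolding F_def by (intro borel_measurable_times_ennreal nn_measurable[OF y] borel_measurable_indicator) simp
  qed
  also have "\<dots> \<le> ennreal c"
    unfolding F integral_nn_integral[OF y] by (intro SUP_least ennreal_leI le) simp
  finally show ?thesis .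
qed

section \<open>Time shifts and dynamic programming\<close>

lemma value_function_le_cost:
  "u \<in> Linf_controls \<Longrightarrow> value_function f g h R x \<le> cost f g h R x u"
  unfolding value_function_def by (rule INF_lower)

lemma Linf_controls_shift:
  assumes u: "u \<in> Linf_controls" and s: "s \<ge> 0"
  shows "(\<lambda>t. u (s + t)) \<in> Linf_controls"
proof -
  obtain C N where um: "u \<in> borel_measurable (lebesgue_on {0..})"
    and C: "C \<ge> 0" "negligible N" "\<forall>t\<ge>0. t \<notin> N \<longrightarrow> norm (u t) \<le> C"
    using u unfolding Linf_controls_iff by (elim conjE exE)
  have "(\<lambda>t. s + t) \<in> lebesgue \<rightarrow>\<^sub>M lebesgue"
    using lebesgue_affine_measurable[of "\<lambda>_. 1" s] by simp
  then have "(\<lambda>t. s + t) \<in> lebesgue_on {0..} \<rightarrow>\<^sub>M lebesgue_on {0..}"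
    by (rule measurable_restrict_space3) (use s in auto)
  then have "(\<lambda>t. u (s + t)) \<in> borel_measurable (lebesgue_on {0..})" using um by (rule measurable_compose)
  moreover have "negligible ((+) (- s) ` N)" using C(2) by (rule negligible_translation)
  moreover have "\<forall>t\<ge>0. t \<notin> (+) (- s) ` N \<longrightarrow> norm (u (s + t)) \<le> C"
  proof (intro allI impI)
    fix t assume t: "t \<ge> 0" "t \<notin> (+) (- s) ` N"
    have "s + t \<notin> N"
    proof
      assume "s + t \<in> N"
      then have "- s + (s + t) \<in> (+) (- s) ` N" by (rule imageI)
      with t show False by simp
    qed
    then show "norm (u (s + t)) \<le> C" using C(3) s t by simp
  qed
  ultimately show ?thesis unfolding Linf_controls_iff using C(1) by blast
qed

lemma global_solution_shift:
  assumes y: "global_solution u x y" and s: "s \<ge> 0"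
  shows "global_solution (\<lambda>t. u (s + t)) (y s) (\<lambda>t. y (s + t))"
  unfolding global_solution_def
proof (intro conjI allI impI)
  show "(\<lambda>t. u (s + t)) \<in> Linf_controls"
    using y s unfolding global_solution_def by (intro Linf_controls_shift) simp_all
  show "y (s + 0) = y s" by simp
  fix b :: real assume b: "b \<ge> 0"
  have "solves_on f g u (b + s) y" using y b s unfolding global_solution_def by simp
  then obtain N where N: "negligible N"
    "\<forall>t\<in>{0<..<b + s} - N. (y has_vector_derivative (f (y t) + g (y t) *v u t)) (at t)"
    and ac: "abs_continuous_on_interval 0 (b + s) y"
    unfolding solves_on_def by (elim conjE exE)
  have "abs_continuous_on_interval (0 + s) (b + s) y" by (rule AC_subset[OF ac]) (use s in simp)
  then have "abs_continuous_on_interval 0 b (\<lambda>t. y (s + t))" by (rule AC_shift)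
  moreover have "negligible ((+) (- s) ` N)" using N(1) by (rule negligible_translation)
  moreover have "((\<lambda>t. y (s + t)) has_vector_derivative (f (y (s + t)) + g (y (s + t)) *v u (s + t))) (at t)"
    if t: "t \<in> {0<..<b} - (+) (- s) ` N" for t
  proof -
    have "s + t \<notin> N"
    proof
      assume "s + t \<in> N"
      then have "- s + (s + t) \<in> (+) (- s) ` N" by (rule imageI)
      with t show False by simp
    qed
    then have "(y has_vector_derivative (f (y (s + t)) + g (y (s + t)) *v u (s + t))) (at (s + t))"
      using N(2) t s by simp
    moreover have "((\<lambda>t. s + t) has_vector_derivative 1) (at t)"
      by (auto intro!: derivative_eq_intros)
    ultimately show ?thesis
      using vector_diff_chain_at[of "\<lambda>t. s + t" 1 t y] by (simp add: o_def)
  qed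
  ultimately show "solves_on f g (\<lambda>t. u (s + t)) b (\<lambda>t. y (s + t))"
    unfolding solves_on_def by blast
qed

text \<open>The tail of the control is admissible for the state reached at time \<open>s\<close>,
  and what is spent before \<open>s\<close> is nonnegative.\<close>

lemma value_function_le_cost_along:
  assumes y: "global_solution u x y" and s: "s \<ge> 0"
  shows "value_function f g h R (y s) \<le> cost f g h R x u"
proof -
  note ys = global_solution_shift[OF y s]
  have "value_function f g h R (y s) \<le> cost f g h R (y s) (\<lambda>t. u (s + t))"
    using ys unfolding global_solution_def by (intro value_function_le_cost) simp
  \<comment> \<open>The form \<open>s + 1 * t\<close> matches the affine substitution rule. The
    indicator at \<open>s + 1 * t\<close> also admits times between \<open>- s\<close> and 0, which
    can only enlarge the integral.\<close>
  also have "\<dots> \<le> (\<integral>\<^sup>+t. ennreal (running_cost h R y u (s + 1 * t)) * indicator {0..} (s + 1 * t) \<partial>lebesgue)"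
    unfolding global_solution_cost[OF ys]
    by (intro nn_integral_mono) (use s in \<open>auto simp: running_cost_def split: split_indicator\<close>)
  also have "\<dots> = cost f g h R x u"
    using nn_integral_real_affine_lebesgue[OF nn_measurable[OF y], of 1 s]
    unfolding global_solution_cost[OF y] by simp
  finally show ?thesis .
qed

end

section \<open>Candidate solutions\<close>

text \<open>The times with norm at least \<open>r\<close> form a compact set; at its least element
  the intermediate value theorem forces the norm to be exactly \<open>r\<close>.\<close>

lemma first_exit_time:
  fixes y :: "real \<Rightarrow> 'a::real_normed_vector"
  assumes y: "continuous_on {0..b} y" and y0: "norm (y 0) < r"
    and t: "t \<in> {0..b}" "r \<le> norm (y t)"
  shows "\<exists>s\<in>{0..b}. norm (y s) = r \<and> (\<forall>t\<in>{0..s}. norm (y t) \<le> r)"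
proof -
  have ny: "continuous_on {0..b} (\<lambda>t. norm (y t))" using y by (rule continuous_on_norm)
  define S where "S = {t \<in> {0..b}. r \<le> norm (y t)}"
  have "closed S"
    unfolding S_def by (rule continuous_on_closed_Collect_le[OF continuous_on_const ny]) simp
  moreover have "bounded S" unfolding S_def by (rule bounded_subset[OF bounded_closed_interval[of 0 b]]) auto
  ultimately have "compact S" by (simp add: compact_eq_bounded_closed)
  moreover have "S \<noteq> {}" using t unfolding S_def by blast
  ultimately obtain s where s: "s \<in> S" "\<forall>t\<in>S. s \<le> t" using compact_attains_inf by blast
  have sb: "s \<in> {0..b}" "r \<le> norm (y s)" using s(1) unfolding S_def by simp_all
  have "continuous_on {0..s} (\<lambda>t. norm (y t))" using ny by (rule continuous_on_subset) (use sb in auto)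
  then have "\<exists>t. 0 \<le> t \<and> t \<le> s \<and> norm (y t) = r"
    using IVT'[of "\<lambda>t. norm (y t)" 0 r s] y0 sb by simp
  then obtain t' where t': "0 \<le> t'" "t' \<le> s" "norm (y t') = r" by (elim exE conjE)
  then have "t' \<in> S" unfolding S_def using sb by simp
  then have "t' = s" using s(2) t'(2) by (simp add: order_antisym)
  moreover have "norm (y t) \<le> r" if "t \<in> {0..s}" for t
  proof (cases "t \<in> S")
    case True
    then have "t = s" using s(2) that by (simp add: order_antisym)
    then show ?thesis using t'(3) \<open>t' = s\<close> by simp
  next
    case False
    then show ?thesis using that sb(1) unfolding S_def by simp
  qed
  ultimately show ?thesis using sb(1) t'(3) by blast
qed

text \<open>All estimates take place in the closed ball of radius \<open>r\<close>: it is compact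
  and convex, so \<open>v\<close> is Lipschitz and the feedback bounded there.\<close>

locale hjb_candidate = control_problem f g h R
  for f :: "real^'n \<Rightarrow> real^'n" and g :: "real^'n \<Rightarrow> real^'m^'n"
    and h :: "real^'n \<Rightarrow> real" and R :: "real^'m^'m" +
  fixes \<Omega> :: "(real^'n) set" and v :: "real^'n \<Rightarrow> real" and \<alpha> \<beta> r :: real
  assumes C1_v: "C1_on \<Omega> v"
    and hjb: "\<And>x. x \<in> \<Omega> \<Longrightarrow> (f x + g x *v feedback g R v x) \<bullet> grad v x + h x
                  + (weighted_norm R (feedback g R v x))\<^sup>2 = 0"
    and v_lower: "\<And>x. x \<in> \<Omega> \<Longrightarrow> \<alpha> * (norm x)\<^sup>2 \<le> v x"
    and v_upper: "\<And>x. x \<in> \<Omega> \<Longrightarrow> v x \<le> \<beta> * (norm x)\<^sup>2"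
    and \<alpha>: "\<alpha> > 0" and \<beta>: "\<beta> > 0" and r: "r > 0" and cball_sub: "cball 0 r \<subseteq> \<Omega>"
begin

abbreviation w :: "real^'n \<Rightarrow> real^'m" where "w \<equiv> feedback g R v"

lemma in_domain: "norm x \<le> r \<Longrightarrow> x \<in> \<Omega>"
  using cball_sub by (simp add: subset_eq)

lemma v_nonneg: "norm x \<le> r \<Longrightarrow> 0 \<le> v x"
  by (rule order_trans[OF _ v_lower[OF in_domain]]) (use \<alpha> in simp_all)

lemma continuous_on_w: "continuous_on (cball 0 r) w"
  by (rule continuous_on_subset[OF continuous_on_feedback[OF C1_g C1_v] cball_sub])

section \<open>Dissipation inequalities inside the ball\<close>

lemma AC_along:
  assumes y: "abs_continuous_on_interval 0 b y" and stay: "\<And>t. t \<in> {0..b} \<Longrightarrow> norm (y t) \<le> r"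
  shows "abs_continuous_on_interval 0 b (\<lambda>t. v (y t))"
proof -
  obtain L where L: "L \<ge> 0" "\<forall>x\<in>cball 0 r. \<forall>y\<in>cball 0 r. norm (v x - v y) \<le> L * norm (x - y)"
    using C1_on_lipschitz_cball[OF C1_v cball_sub] by (elim exE conjE)
  show ?thesis
    by (rule AC_dominated[OF y y L(1), of 0]) (use L(2) stay in simp_all)
qed

lemma derivative_along:
  assumes y: "(y has_vector_derivative (f (y t) + g (y t) *v u t)) (at t)" and yt: "norm (y t) \<le> r"
  shows "((\<lambda>t. v (y t)) has_vector_derivative
    (- running_cost h R y u t + (u t - w (y t)) \<bullet> (R *v (u t - w (y t))))) (at t)"
proof -
  note dom = in_domain[OF yt]
  have "(v \<circ> y has_vector_derivative ((f (y t) + g (y t) *v u t) \<bullet> grad v (y t))) (at t)"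
    by (rule vector_derivative_diff_chain_within[OF y has_derivative_at_withinI[OF C1_on_grad(1)[OF C1_v dom]]])
  then show ?thesis
    unfolding hjb_complete_square[where f = f and g = g and h = h and v = v, OF R hjb[OF dom]] running_cost_def o_def .
qed

text \<open>The square in \<open>derivative_along\<close> is nonnegative for every control; dropping
  it shows that \<open>v\<close> falls by at most the cost spent.\<close>

lemma dissipation_lower:
  assumes y: "solves_on f g u b y" and b: "0 \<le> b" and stay: "\<And>t. t \<in> {0..b} \<Longrightarrow> norm (y t) \<le> r"
    and int: "running_cost h R y u integrable_on {0..b}"
  shows "v (y 0) \<le> v (y b) + integral {0..b} (running_cost h R y u)"
proof -
  obtain N where N: "negligible N"
    "\<forall>t\<in>{0<..<b} - N. (y has_vector_derivative (f (y t) + g (y t) *v u t)) (at t)"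
    and ac: "abs_continuous_on_interval 0 b y"
    using y unfolding solves_on_def by (elim conjE exE)
  have "- integral {0..b} (running_cost h R y u) \<le> v (y b) - v (y 0)"
  proof (rule AC_diff_ge[OF b AC_along[OF ac stay] N(1)])
    show "((\<lambda>t. - running_cost h R y u t) has_integral - integral {0..b} (running_cost h R y u)) {0..b}"
      using int by (intro has_integral_neg integrable_integral)
    fix t assume t: "t \<in> {0<..<b} - N"
    have "norm (y t) \<le> r" using t by (intro stay) simp
    note D = derivative_along[where u = u, OF bspec[OF N(2) t] this]
    show "\<exists>D. ((\<lambda>t. v (y t)) has_vector_derivative D) (at t) \<and> - running_cost h R y u t \<le> D"
      by (intro exI conjI, rule D) (simp add: sym_pos_def_nonneg[OF R])
  qed
  then show ?thesis by simp
qed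

text \<open>The square is at most \<open>2 * (u t \<bullet> (R *v u t)) + C\<close>, so
  \<open>v\<close> grows at a rate of at most the running cost plus \<open>C\<close>. No pointwise
  bound on the control enters, as a small cost would not give one.\<close>

lemma dissipation_upper:
  assumes y: "solves_on f g u b y" and b: "0 \<le> b" and stay: "\<And>t. t \<in> {0..b} \<Longrightarrow> norm (y t) \<le> r"
    and int: "running_cost h R y u integrable_on {0..b}"
    and C: "\<And>x. norm x \<le> r \<Longrightarrow> 2 * (w x \<bullet> (R *v w x)) \<le> C"
  shows "v (y b) \<le> v (y 0) + integral {0..b} (running_cost h R y u) + C * b"
proof -
  obtain N where N: "negligible N"
    "\<forall>t\<in>{0<..<b} - N. (y has_vector_derivative (f (y t) + g (y t) *v u t)) (at t)"
    and ac: "abs_continuous_on_interval 0 b y"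
    using y unfolding solves_on_def by (elim conjE exE)
  have "v (y b) - v (y 0) \<le> integral {0..b} (running_cost h R y u) + C * b"
  proof (rule AC_diff_le[OF b AC_along[OF ac stay] N(1)])
    have "((\<lambda>_. C) has_integral C * b) {0..b}"
      using has_integral_const_real[of C 0 b] b by (simp add: mult.commute)
    then show "((\<lambda>t. running_cost h R y u t + C) has_integral integral {0..b} (running_cost h R y u) + C * b) {0..b}"
      using int by (intro has_integral_add integrable_integral)
    fix t assume t: "t \<in> {0<..<b} - N"
    have yt: "norm (y t) \<le> r" using t by (intro stay) simp
    have "(u t - w (y t)) \<bullet> (R *v (u t - w (y t))) \<le> 2 * (u t \<bullet> (R *v u t)) + C"
      using sym_pos_def_diff_le[OF R, of "u t" "w (y t)"] C[OF yt] by linarith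
    then have "- running_cost h R y u t + (u t - w (y t)) \<bullet> (R *v (u t - w (y t))) \<le> running_cost h R y u t + C"
      unfolding running_cost_def using h_nonneg[of "y t"] by linarith
    with derivative_along[where u = u, OF bspec[OF N(2) t] yt]
    show "\<exists>D. ((\<lambda>t. v (y t)) has_vector_derivative D) (at t) \<and> D \<le> running_cost h R y u t + C"
      by (intro exI conjI)
  qed
  then show ?thesis by simp
qed

text \<open>For the feedback the square vanishes. The comparison function \<open>k\<close> is left
  free for two uses: 0 traps the closed loop before its control is known to be admissible, and minus
  the running cost bounds its cost.\<close>

lemma dissipation_feedback:
  assumes y: "abs_continuous_on_interval 0 b y" and b: "0 \<le> b"
    and der: "\<And>t. t \<in> {0<..<b} \<Longrightarrow> (y has_vector_derivative (f (y t) + g (y t) *v w (y t))) (at t)"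
    and stay: "\<And>t. t \<in> {0..b} \<Longrightarrow> norm (y t) \<le> r"
    and k: "\<And>t. - running_cost h R y (\<lambda>t. w (y t)) t \<le> k t" "(k has_integral I) {0..b}"
  shows "v (y b) - v (y 0) \<le> I"
proof (rule AC_diff_le[OF b AC_along[OF y stay] negligible_empty _ k(2)])
  fix t assume t: "t \<in> {0<..<b} - {}"
  have yt: "norm (y t) \<le> r" using t by (intro stay) simp
  have "(y has_vector_derivative (f (y t) + g (y t) *v w (y t))) (at t)" using t by (intro der) simp
  note D = derivative_along[where u = "\<lambda>t. w (y t)", OF this yt]
  show "\<exists>D. ((\<lambda>t. v (y t)) has_vector_derivative D) (at t) \<and> D \<le> k t"
    by (intro exI conjI, rule D) (use k(1)[of t] in simp)
qed

text \<open>The closed loop has a merely continuous right-hand side, so its trajectory comes from Peano's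
  theorem, applied to the field composed with the projection onto the ball.\<close>

lemma closed_loop_trajectory:
  assumes x: "norm x < r" "\<beta> * (norm x)\<^sup>2 < \<alpha> * r\<^sup>2"
  shows "\<exists>y. global_solution (\<lambda>t. w (y t)) x y \<and> (\<forall>t\<ge>0. norm (y t) \<le> r)
    \<and> (\<forall>t>0. (y has_vector_derivative (f (y t) + g (y t) *v w (y t))) (at t))"
proof -
  define F where "F z = f z + g z *v w z" for z
  define P where "P = closest_point (cball (0::real^'n) r)"
  have ne: "cball (0::real^'n) r \<noteq> {}" using r by simp
  have Pin: "P z \<in> cball 0 r" for z unfolding P_def by (rule closest_point_in_set[OF closed_cball ne])
  have Pid: "P z = z" if "norm z \<le> r" for z unfolding P_def using that by (intro closest_point_self) simp
  have contP: "continuous_on UNIV P" unfolding P_def by (rule continuous_on_closest_point[OF convex_cball closed_cball ne])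
  have contf: "continuous_on (cball 0 r) f" "continuous_on (cball 0 r) g"
    using continuous_on_subset[OF C1_on_continuous_on[OF C1_f]] continuous_on_subset[OF C1_on_continuous_on[OF C1_g]] by simp_all
  have contF: "continuous_on (cball 0 r) F"
    unfolding F_def by (intro continuous_on_add contf continuous_on_matrix_vector_mult continuous_on_w)
  have contFP: "continuous_on UNIV (\<lambda>z. F (P z))"
    by (rule continuous_on_compose2[OF contF contP]) (use Pin in blast)
  have "bounded (F ` cball 0 r)"
    by (rule compact_imp_bounded[OF compact_continuous_image[OF contF compact_cball]])
  then obtain M where "\<forall>q\<in>F ` cball 0 r. norm q \<le> M" unfolding bounded_iff by (elim exE)
  then have M: "norm (F (P z)) \<le> M" for z using Pin by blast
  have "\<exists>y. y 0 = x \<and> (\<forall>s t. 0 \<le> s \<longrightarrow> 0 \<le> t \<longrightarrow> norm (y t - y s) \<le> M * \<bar>t - s\<bar>)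
      \<and> (\<forall>t>0. (y has_vector_derivative F (P (y t))) (at t))"
  proof (rule peano_existence[where F = "\<lambda>z. F (P z)" and x = x, OF contFP M])
    fix y assume "y 0 = x" "\<And>s t. 0 \<le> s \<Longrightarrow> 0 \<le> t \<Longrightarrow> norm (y t - y s) \<le> M * \<bar>t - s\<bar>"
      "\<And>t. t > 0 \<Longrightarrow> (y has_vector_derivative F (P (y t))) (at t)"
    then show ?thesis by (intro exI[of _ y] conjI allI impI)
  qed
  then obtain y where y0: "y 0 = x"
    and lip: "\<forall>s t. 0 \<le> s \<longrightarrow> 0 \<le> t \<longrightarrow> norm (y t - y s) \<le> M * \<bar>t - s\<bar>"
    and der: "\<forall>t>0. (y has_vector_derivative F (P (y t))) (at t)"
    by (elim exE conjE)
  have "M \<ge> 0" using order_trans[OF norm_ge_zero M] .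
  have ac: "abs_continuous_on_interval 0 b y" for b
    by (rule AC_lipschitz[OF \<open>M \<ge> 0\<close>]) (use lip in simp)
  have stay: "norm (y b) < r" if b: "b \<ge> 0" for b
  proof (rule ccontr)
    assume "\<not> norm (y b) < r"
    then have "\<exists>s\<in>{0..b}. norm (y s) = r \<and> (\<forall>t\<in>{0..s}. norm (y t) \<le> r)"
      using b x(1) y0 by (intro first_exit_time[where t = b, OF AC_continuous_on[OF ac]]) simp_all
    then obtain s where s: "s \<in> {0..b}" "norm (y s) = r" "\<forall>t\<in>{0..s}. norm (y t) \<le> r" by (elim bexE conjE)
    \<comment> \<open>Up to the first exit the projection is inactive and \<open>v\<close> does not
      increase, whereas at radius \<open>r\<close> it would be at least
      \<open>\<alpha> * r\<^sup>2\<close>, which exceeds \<open>v x\<close>.\<close>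
    have "v (y s) - v (y 0) \<le> 0"
    proof (rule dissipation_feedback[OF ac])
      show "0 \<le> s" using s(1) by simp
      show "((\<lambda>_. 0) has_integral 0) {0..s}" by simp
      show "norm (y t) \<le> r" if "t \<in> {0..s}" for t using s(3) that by blast
      show "- running_cost h R y (\<lambda>t. w (y t)) t \<le> 0" for t using running_cost_nonneg by simp
      show "(y has_vector_derivative (f (y t) + g (y t) *v w (y t))) (at t)" if t: "t \<in> {0<..<s}" for t
      proof -
        have "norm (y t) \<le> r" using s(3) t by simp
        moreover have "(y has_vector_derivative F (P (y t))) (at t)" using der t by simp
        ultimately show ?thesis by (simp add: Pid F_def)
      qed
    qed
    then have "v (y s) \<le> v x" using y0 by simp
    moreover have "\<alpha> * r\<^sup>2 \<le> v (y s)" using v_lower[of "y s"] in_domain[of "y s"] s(2) by simp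
    moreover have "v x \<le> \<beta> * (norm x)\<^sup>2" using v_upper[of x] in_domain[of x] x(1) by simp
    ultimately show False using x(2) by linarith
  qed
  have der': "(y has_vector_derivative (f (y t) + g (y t) *v w (y t))) (at t)" if "t > 0" for t
  proof -
    have "norm (y t) \<le> r" using stay[of t] that by simp
    moreover have "(y has_vector_derivative F (P (y t))) (at t)" using der that by simp
    ultimately show ?thesis by (simp add: Pid F_def)
  qed
  have sol: "solves_on f g (\<lambda>t. w (y t)) b y" for b
    unfolding solves_on_def using ac der' by (intro conjI exI[of _ "{}"]) simp_all
  have conty: "continuous_on {0..} y" by (rule solves_on_continuous_on[OF sol])
  \<comment> \<open>From here on \<open>w (y t)\<close> is treated as an open-loop control:
    continuity makes it measurable, and confinement to the ball makes it bounded.\<close>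
  have "continuous_on {0..} (\<lambda>t. w (y t))"
    by (rule continuous_on_compose2[OF continuous_on_w conty]) (use stay in \<open>auto simp: less_imp_le\<close>)
  then have meas: "(\<lambda>t. w (y t)) \<in> borel_measurable (lebesgue_on {0..})"
    by (rule continuous_imp_measurable_on_sets_lebesgue) simp
  have "bounded (w ` cball 0 r)"
    by (rule compact_imp_bounded[OF compact_continuous_image[OF continuous_on_w compact_cball]])
  then obtain W where W: "\<forall>q\<in>w ` cball 0 r. norm q \<le> W" unfolding bounded_iff by (elim exE)
  have "norm (w (y t)) \<le> max W 0" if "t \<ge> 0" for t
    using bspec[OF W imageI, of "y t"] stay[OF that] by simp
  then have "\<exists>C\<ge>0. \<exists>N. negligible N \<and> (\<forall>t\<ge>0. t \<notin> N \<longrightarrow> norm (w (y t)) \<le> C)"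
    by (intro exI[of _ "max W 0"] conjI exI[of _ "{}"]) simp_all
  then have "(\<lambda>t. w (y t)) \<in> Linf_controls" unfolding Linf_controls_iff using meas by blast
  then have "global_solution (\<lambda>t. w (y t)) x y" unfolding global_solution_def using y0 sol by simp
  then show ?thesis using stay der' by (intro exI[of _ y] conjI allI impI) (simp_all add: less_imp_le)
qed

lemma value_function_le:
  assumes x: "norm x < r" "\<beta> * (norm x)\<^sup>2 < \<alpha> * r\<^sup>2"
  shows "value_function f g h R x \<le> ennreal (v x)"
proof -
  obtain y where y: "global_solution (\<lambda>t. w (y t)) x y" and stay: "\<forall>t\<ge>0. norm (y t) \<le> r"
    and der: "\<forall>t>0. (y has_vector_derivative (f (y t) + g (y t) *v w (y t))) (at t)"
    using closed_loop_trajectory[OF x] by (elim exE conjE)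
  have "value_function f g h R x \<le> cost f g h R x (\<lambda>t. w (y t))"
    using y unfolding global_solution_def by (intro value_function_le_cost) simp
  also have "\<dots> \<le> ennreal (v x)"
  proof (rule cost_le[OF y])
    fix b :: real assume b: "b \<ge> 0"
    let ?l = "running_cost h R y (\<lambda>t. w (y t))"
    have ac: "abs_continuous_on_interval 0 b y" using y b unfolding global_solution_def solves_on_def by simp
    have "v (y b) - v (y 0) \<le> - integral {0..b} ?l"
    proof (rule dissipation_feedback[OF ac b])
      show "((\<lambda>t. - ?l t) has_integral - integral {0..b} ?l) {0..b}"
        by (intro has_integral_neg integrable_integral global_solution_integrable[OF y])
    qed (use stay der in simp_all)
    moreover have "y 0 = x" using y unfolding global_solution_def by simp
    moreover have "0 \<le> v (y b)" using stay b by (intro v_nonneg) simp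
    ultimately show "integral {0..b} ?l \<le> v x" by simp
  qed
  finally show ?thesis .
qed

section \<open>Lower bounds on the cost\<close>

lemma h_bounded_below:
  assumes "\<eta> > 0"
  shows "\<exists>\<kappa>>0. \<forall>x. \<eta> \<le> norm x \<longrightarrow> norm x \<le> r \<longrightarrow> \<kappa> \<le> h x"
proof -
  define A where "A = {x \<in> cball 0 r. \<eta> \<le> norm (x::real^'n)}"
  have "closed A" unfolding A_def
    by (rule continuous_on_closed_Collect_le) (simp_all add: continuous_on_const continuous_on_norm_id)
  moreover have "bounded A" unfolding A_def by (rule bounded_subset[OF bounded_cball[of 0 r]]) auto
  ultimately have "compact A" by (simp add: compact_eq_bounded_closed)
  show ?thesis
  proof (cases "A = {}")
    case True
    then show ?thesis unfolding A_def by (intro exI[of _ 1]) auto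
  next
    case False
    have "continuous_on A h" using cont_h by (rule continuous_on_subset) simp
    then obtain z where z: "z \<in> A" "\<forall>x\<in>A. h z \<le> h x"
      using continuous_attains_inf[OF \<open>compact A\<close> False] by blast
    have "z \<noteq> 0" using z(1) assms unfolding A_def by auto
    then have "h z > 0" by (rule h_pos)
    then show ?thesis using z(2) unfolding A_def by (intro exI[of _ "h z"]) simp
  qed
qed

text \<open>A trajectory with small cost cannot leave the ball quickly, since \<open>v\<close> grows along it at a
  bounded rate, and it cannot approach the origin, since \<open>v\<close> decreases by at most the cost; meanwhile
  it pays for staying in an annulus.\<close>

lemma cost_bounded_below_on_sphere:
  assumes s: "0 < s" "s < r" "\<beta> * s\<^sup>2 < \<alpha> * r\<^sup>2"
  shows "\<exists>c>0. \<forall>z. norm z = s \<longrightarrow> (\<forall>u\<in>Linf_controls. ennreal c \<le> cost f g h R z u)"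
proof -
  have "continuous_on (cball 0 r) (\<lambda>x. 2 * (w x \<bullet> (R *v w x)))"
    by (intro continuous_on_mult continuous_on_inner continuous_on_matrix_vector_mult continuous_on_const continuous_on_w)
  then have "bounded ((\<lambda>x. 2 * (w x \<bullet> (R *v w x))) ` cball 0 r)"
    by (rule compact_imp_bounded[OF compact_continuous_image[OF _ compact_cball]])
  then obtain W where W: "\<forall>q\<in>(\<lambda>x. 2 * (w x \<bullet> (R *v w x))) ` cball 0 r. norm q \<le> W" unfolding bounded_iff by (elim exE)
  define C where "C = max W 0"
  have C0: "C \<ge> 0" unfolding C_def by simp
  have C: "2 * (w x \<bullet> (R *v w x)) \<le> C" if "norm x \<le> r" for x
    using bspec[OF W imageI, of x] that unfolding C_def by simp
  \<comment> \<open>A guaranteed gap between \<open>v\<close> at radius \<open>r\<close> and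
    \<open>v\<close> at radius \<open>s\<close>. A cost below \<open>\<epsilon>\<close> and a
    duration of at most \<open>\<tau>\<close> each account for at most a third of it, so the
    trajectory cannot leave the ball by time \<open>\<tau>\<close>. The denominator
    \<open>C + 1\<close> covers \<open>C = 0\<close>.\<close>
  define d where "d = \<alpha> * r\<^sup>2 - \<beta> * s\<^sup>2"
  have d: "d > 0" unfolding d_def using s(3) by simp
  define \<epsilon> where "\<epsilon> = min (\<alpha> * s\<^sup>2 / 2) (d / 3)"
  define \<tau> where "\<tau> = d / (3 * (C + 1))"
  have \<epsilon>: "\<epsilon> > 0" "\<epsilon> \<le> \<alpha> * s\<^sup>2 / 2" "\<epsilon> \<le> d / 3" unfolding \<epsilon>_def using \<alpha> s(1) d by simp_all
  have \<tau>: "\<tau> > 0" unfolding \<tau>_def using d C0 by simp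
  have C\<tau>: "C * \<tau> \<le> d / 3"
  proof -
    have "C * \<tau> \<le> (C + 1) * \<tau>" using \<tau> by simp
    also have "\<dots> = d / 3" unfolding \<tau>_def using C0 by (simp add: field_simps)
    finally show ?thesis .
  qed
  \<comment> \<open>Chosen with \<open>\<beta> * \<eta>\<^sup>2 = \<alpha> * s\<^sup>2 / 2\<close>:
    while the cost is below \<open>\<epsilon>\<close>, \<open>v\<close> keeps at least half of
    \<open>\<alpha> * s\<^sup>2\<close>, which forces the norm to be at least
    \<open>\<eta>\<close>.\<close>
  define \<eta> where "\<eta> = sqrt (\<alpha> * s\<^sup>2 / (2 * \<beta>))"
  have \<eta>: "\<eta> > 0" "\<eta>\<^sup>2 = \<alpha> * s\<^sup>2 / (2 * \<beta>)" unfolding \<eta>_def using \<alpha> \<beta> s(1) by simp_all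
  obtain \<kappa> where \<kappa>: "\<kappa> > 0" "\<forall>x. \<eta> \<le> norm x \<longrightarrow> norm x \<le> r \<longrightarrow> \<kappa> \<le> h x"
    using h_bounded_below[OF \<eta>(1)] by (elim exE conjE)
  have main: "ennreal (min \<epsilon> (\<kappa> * \<tau>)) \<le> cost f g h R z u" if z: "norm z = s" and u: "u \<in> Linf_controls" for z u
  \<comment> \<open>Either the cost is at least \<open>\<epsilon>\<close>, or all of
    \<open>{0..\<tau>}\<close> is spent in the annulus at a price of at least
    \<open>\<kappa>\<close> per unit of time.\<close>
  proof (cases "ennreal \<epsilon> \<le> cost f g h R z u")
    case True
    have "ennreal (min \<epsilon> (\<kappa> * \<tau>)) \<le> ennreal \<epsilon>" by (rule ennreal_leI) simp
    then show ?thesis using True by (rule order_trans)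
  next
    case False
    then have lt: "cost f g h R z u < ennreal \<epsilon>" by simp
    then have "cost f g h R z u \<noteq> \<infinity>" by auto
    then obtain y where y: "global_solution u z y" using cost_finite_global_solution[OF u] by blast
    define l where "l = running_cost h R y u"
    have y0: "y 0 = z" and sol: "\<And>b. b \<ge> 0 \<Longrightarrow> solves_on f g u b y"
      using y unfolding global_solution_def by simp_all
    have int: "l integrable_on {0..b}" for b unfolding l_def by (rule global_solution_integrable[OF y])
    have Il: "integral {0..b} l < \<epsilon>" for b
    proof -
      have "ennreal (integral {0..b} l) < ennreal \<epsilon>"
        unfolding l_def using integral_le_cost[OF y] lt by (rule le_less_trans)
      moreover have "integral {0..b} l \<ge> 0"
        using int by (rule integral_nonneg) (simp add: l_def running_cost_nonneg)
      ultimately show ?thesis by (simp add: ennreal_less_iff)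
    qed
    have vz: "\<alpha> * s\<^sup>2 \<le> v z" "v z \<le> \<beta> * s\<^sup>2"
      using v_lower[of z] v_upper[of z] in_domain[of z] z s(2) by simp_all
    have stay: "norm (y t) < r" if t: "t \<in> {0..\<tau>}" for t
    proof (rule ccontr)
      assume "\<not> norm (y t) < r"
      moreover have "continuous_on {0..\<tau>} y"
        using global_solution_continuous[OF y] by (rule continuous_on_subset) auto
      ultimately have "\<exists>s\<in>{0..\<tau>}. norm (y s) = r \<and> (\<forall>t\<in>{0..s}. norm (y t) \<le> r)"
        using t y0 z s(2) by (intro first_exit_time[where t = t]) simp_all
      then obtain q where q: "q \<in> {0..\<tau>}" "norm (y q) = r" "\<forall>t\<in>{0..q}. norm (y t) \<le> r" by (elim bexE conjE)
      have "v (y q) \<le> v (y 0) + integral {0..q} l + C * q"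
        unfolding l_def using q sol C int[unfolded l_def] by (intro dissipation_upper) simp_all
      moreover have "C * q \<le> C * \<tau>" using q(1) C0 by (intro mult_left_mono) simp_all
      moreover have "\<alpha> * r\<^sup>2 \<le> v (y q)" using v_lower[of "y q"] in_domain[of "y q"] q(2) by simp
      moreover have "\<alpha> * r\<^sup>2 = \<beta> * s\<^sup>2 + d" unfolding d_def by simp
      moreover have "3 * \<epsilon> \<le> d" "3 * (C * \<tau>) \<le> d" using \<epsilon>(3) C\<tau> by simp_all
      ultimately show False using Il[of q] vz(2) d unfolding y0 by linarith
    qed
    have far: "\<kappa> \<le> l t" if t: "t \<in> {0..\<tau>}" for t
    proof -
      have "v (y 0) \<le> v (y t) + integral {0..t} l"
        unfolding l_def using t sol int[unfolded l_def] stay by (intro dissipation_lower) (simp_all add: less_imp_le)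
      moreover have "v (y t) \<le> \<beta> * (norm (y t))\<^sup>2"
        using v_upper in_domain stay[OF t] by (simp add: less_imp_le)
      ultimately have "\<alpha> * s\<^sup>2 / 2 \<le> \<beta> * (norm (y t))\<^sup>2"
        using vz(1) Il[of t] \<epsilon>(2) unfolding y0 by linarith
      then have "\<eta>\<^sup>2 \<le> (norm (y t))\<^sup>2" unfolding \<eta>(2) using \<beta> by (simp add: field_simps)
      then have "\<eta> \<le> norm (y t)" by (rule power2_le_imp_le) simp
      then have "\<kappa> \<le> h (y t)" using \<kappa>(2) stay[OF t] by (simp add: less_imp_le)
      then show ?thesis unfolding l_def running_cost_def using sym_pos_def_nonneg[OF R, of "u t"] by linarith
    qed
    have "\<kappa> * \<tau> = integral {0..\<tau>} (\<lambda>_. \<kappa>)" using \<tau> by simp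
    also have "\<dots> \<le> integral {0..\<tau>} l" by (rule integral_le[OF integrable_const_ivl int far])
    finally have "ennreal (min \<epsilon> (\<kappa> * \<tau>)) \<le> ennreal (integral {0..\<tau>} l)" by (intro ennreal_leI) simp
    also have "\<dots> \<le> cost f g h R z u" unfolding l_def by (rule integral_le_cost[OF y])
    finally show ?thesis .
  qed
  show ?thesis
    using main \<epsilon>(1) \<kappa>(1) \<tau> by (intro exI[of _ "min \<epsilon> (\<kappa> * \<tau>)"]) simp
qed

text \<open>By the dynamic programming inequality a control of cost below the values on the sphere keeps
  the trajectory inside; finiteness of the cost then forces it to come close to the origin.\<close>

lemma candidate_le_cost:
  assumes s: "s \<le> r" and x: "norm x < s" and u: "u \<in> Linf_controls"
    and sphere: "\<And>z. norm z = s \<Longrightarrow> m \<le> value_function f g h R z"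
    and m: "cost f g h R x u < m"
  shows "ennreal (v x) \<le> cost f g h R x u"
proof -
  have fin: "cost f g h R x u \<noteq> \<infinity>" using m by auto
  then obtain y where y: "global_solution u x y" using cost_finite_global_solution[OF u] by blast
  obtain c where c: "c \<ge> 0" "cost f g h R x u = ennreal c"
    using fin by (cases "cost f g h R x u") auto
  define l where "l = running_cost h R y u"
  have y0: "y 0 = x" and sol: "\<And>b. b \<ge> 0 \<Longrightarrow> solves_on f g u b y"
    using y unfolding global_solution_def by simp_all
  have int: "l integrable_on {0..b}" for b unfolding l_def by (rule global_solution_integrable[OF y])
  have Il: "integral {0..b} l \<le> c" for b
    using integral_le_cost[OF y, of b] c unfolding l_def by simp
  \<comment> \<open>A path leaving the ball of radius \<open>r\<close> meets the sphere of radius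
    \<open>s\<close>; the optimal value there is at least \<open>m\<close>, more than the whole
    control costs.\<close>
  have stay: "norm (y t) \<le> r" if t: "t \<ge> 0" for t
  proof (rule ccontr)
    assume "\<not> norm (y t) \<le> r"
    moreover have "continuous_on {0..t} y"
      using global_solution_continuous[OF y] by (rule continuous_on_subset) auto
    ultimately have "\<exists>q\<in>{0..t}. norm (y q) = s \<and> (\<forall>t\<in>{0..q}. norm (y t) \<le> s)"
      using t y0 x s by (intro first_exit_time[where t = t]) simp_all
    then obtain q where q: "q \<in> {0..t}" "norm (y q) = s" by (elim bexE conjE)
    have "m \<le> value_function f g h R (y q)" by (rule sphere[OF q(2)])
    also have "\<dots> \<le> cost f g h R x u" using q(1) by (intro value_function_le_cost_along[OF y]) simp
    finally show False using m by simp
  qed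
  have close: "\<exists>b\<ge>0. norm (y b) < \<eta>" if \<eta>: "\<eta> > 0" for \<eta>
  proof (rule ccontr)
    assume "\<not> (\<exists>b\<ge>0. norm (y b) < \<eta>)"
    then have far: "\<eta> \<le> norm (y b)" if "b \<ge> 0" for b using that by (simp add: not_less)
    obtain \<kappa> where \<kappa>: "\<kappa> > 0" "\<forall>x. \<eta> \<le> norm x \<longrightarrow> norm x \<le> r \<longrightarrow> \<kappa> \<le> h x"
      using h_bounded_below[OF \<eta>] by (elim exE conjE)
    \<comment> \<open>Keeping away from the origin for this long would cost at least
      \<open>c + 1\<close>.\<close>
    define b where "b = (c + 1) / \<kappa>"
    have b: "b \<ge> 0" unfolding b_def using c(1) \<kappa>(1) by simp
    have "\<kappa> \<le> l t" if "t \<in> {0..b}" for t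
    proof -
      have "\<kappa> \<le> h (y t)" using \<kappa>(2) far[of t] stay[of t] that by simp
      then show ?thesis unfolding l_def running_cost_def using sym_pos_def_nonneg[OF R, of "u t"] by linarith
    qed
    then have "integral {0..b} (\<lambda>_. \<kappa>) \<le> integral {0..b} l" by (rule integral_le[OF integrable_const_ivl int])
    moreover have "integral {0..b} (\<lambda>_. \<kappa>) = c + 1" using b \<kappa>(1) by (simp add: b_def)
    ultimately show False using Il[of b] by linarith
  qed
  \<comment> \<open>At a time when \<open>v\<close> is at most \<open>e\<close> it has dropped by at
    most \<open>c\<close> from \<open>v x\<close>; here \<open>e\<close> is arbitrary.\<close>
  have "v x \<le> c"
  proof (rule field_le_epsilon)
    fix e :: real assume e: "e > 0"
    define \<eta> where "\<eta> = sqrt (e / \<beta>)"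
    have \<eta>: "\<eta> > 0" "\<eta>\<^sup>2 = e / \<beta>" unfolding \<eta>_def using e \<beta> by simp_all
    obtain b where b: "b \<ge> 0" "norm (y b) < \<eta>" using close[OF \<eta>(1)] by (elim exE conjE)
    have "(norm (y b))\<^sup>2 \<le> \<eta>\<^sup>2" using b(2) by (intro power_mono) simp_all
    then have "\<beta> * (norm (y b))\<^sup>2 \<le> \<beta> * (e / \<beta>)" unfolding \<eta>(2) using \<beta> by (intro mult_left_mono) simp_all
    then have "\<beta> * (norm (y b))\<^sup>2 \<le> e" using \<beta> by simp
    moreover have "v (y b) \<le> \<beta> * (norm (y b))\<^sup>2" using v_upper in_domain stay b(1) by simp
    moreover have "v (y 0) \<le> v (y b) + integral {0..b} l"
      unfolding l_def using b(1) sol int[unfolded l_def] stay by (intro dissipation_lower) simp_all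
    ultimately show "v x \<le> c + e" using Il[of b] unfolding y0 by linarith
  qed
  then show ?thesis unfolding c(2) by (rule ennreal_leI)
qed

text \<open>Controls of cost below \<open>c\<close> cannot reach the sphere and fall under
  \<open>candidate_le_cost\<close>. All others cost at least \<open>c\<close>, which exceeds
  \<open>\<beta> * (norm x)\<^sup>2\<close> and hence \<open>v x\<close>. The closed loop gives the
  reverse inequality.\<close>

lemma candidate_eq_value_function:
  assumes s: "0 < s" "s < r" "\<beta> * s\<^sup>2 < \<alpha> * r\<^sup>2"
    and sphere: "\<And>z. norm z = s \<Longrightarrow> ennreal c \<le> value_function f g h R z"
    and x: "norm x < s" "\<beta> * (norm x)\<^sup>2 < c"
  shows "ennreal (v x) = value_function f g h R x"
proof (rule antisym)
  have "\<beta> * (norm x)\<^sup>2 \<le> \<beta> * s\<^sup>2" using x(1) \<beta> by (intro mult_left_mono power_mono) simp_all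
  then show "value_function f g h R x \<le> ennreal (v x)"
    using x(1) s by (intro value_function_le) simp_all
  show "ennreal (v x) \<le> value_function f g h R x"
    unfolding value_function_def
  proof (rule INF_greatest)
    fix u :: "real \<Rightarrow> real^'m" assume u: "u \<in> Linf_controls"
    show "ennreal (v x) \<le> cost f g h R x u"
    proof (cases "cost f g h R x u < ennreal c")
      case True
      then show ?thesis using candidate_le_cost[OF _ x(1) u sphere] s(2) by simp
    next
      case False
      have "v x \<le> c" using v_upper[of x] in_domain[of x] x s(2) by simp
      then have "ennreal (v x) \<le> ennreal c" by (rule ennreal_leI)
      with False show ?thesis by simp
    qed
  qed
qed

end

section \<open>Uniform choice of the neighbourhood\<close>

theorem corollary2p3:
  fixes \<Omega> :: "(real^'n) set" and vstar :: "real^'n \<Rightarrow> ennreal" and \<alpha> \<beta> :: real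
  assumes "open \<Omega>" and "connected \<Omega>" and "0 \<in> \<Omega>"
    and "\<forall>x\<in>\<Omega>. vstar x \<noteq> \<infinity>" and "C1_on \<Omega> (\<lambda>x. enn2real (vstar x))"
    and "\<alpha> > 0" and "\<beta> > 0"
  shows "\<exists>\<Omega>'. open \<Omega>' \<and> 0 \<in> \<Omega>' \<and> \<Omega>' \<subseteq> \<Omega> \<and>
    (\<forall>(f :: real^'n \<Rightarrow> real^'n) (g :: real^'n \<Rightarrow> real^'m^'n) (h :: real^'n \<Rightarrow> real) (R :: real^'m^'m).
      standing_assumptions f g h R \<and> value_function f g h R = vstar \<longrightarrow>
      (\<forall>v :: real^'n \<Rightarrow> real.
        C1_on \<Omega> v \<and>
        (\<forall>x\<in>\<Omega>. v x \<ge> 0) \<and> v 0 = 0 \<and>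
        (\<forall>x\<in>\<Omega>. (f x + g x *v feedback g R v x) \<bullet> grad v x + h x
                  + (weighted_norm R (feedback g R v x))\<^sup>2 = 0) \<and>
        (\<forall>x\<in>\<Omega>. \<alpha> * (norm x)\<^sup>2 \<le> v x \<and> v x \<le> \<beta> * (norm x)\<^sup>2) \<longrightarrow>
        (\<forall>x\<in>\<Omega>'. ennreal (v x) = value_function f g h R x)))"
proof -
  obtain r where r: "r > 0" "cball 0 r \<subseteq> \<Omega>" using assms(1,3) open_contains_cball by blast
  \<comment> \<open>As \<open>q\<^sup>2 \<le> q\<close>, this gives \<open>\<beta> * q\<^sup>2 \<le>
    \<beta> * (\<alpha> / (\<alpha> + \<beta>)) < \<alpha>\<close>; scaling by \<open>r\<close>
    yields the gap between the two spheres.\<close>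
  define q where "q = min (1/2) (\<alpha> / (\<alpha> + \<beta>))"
  have q: "0 < q" "q < 1" unfolding q_def using assms(6,7) by simp_all
  have "\<beta> * q\<^sup>2 < \<alpha>"
  proof -
    have "q\<^sup>2 \<le> q" using q by (simp add: power2_eq_square mult_le_cancel_left1)
    then have "\<beta> * q\<^sup>2 \<le> \<beta> * (\<alpha> / (\<alpha> + \<beta>))"
      using assms(7) by (intro mult_left_mono) (simp_all add: q_def)
    also have "\<dots> < \<alpha>" using assms(6,7) by (simp add: field_simps)
    finally show ?thesis .
  qed
  define s where "s = q * r"
  have s: "0 < s" "s < r" unfolding s_def using q r(1) by simp_all
  have "\<beta> * s\<^sup>2 = (\<beta> * q\<^sup>2) * r\<^sup>2" unfolding s_def by (simp add: power_mult_distrib)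
  also have "\<dots> < \<alpha> * r\<^sup>2" using \<open>\<beta> * q\<^sup>2 < \<alpha>\<close> r(1) by (intro mult_strict_right_mono) simp_all
  finally have s2: "\<beta> * s\<^sup>2 < \<alpha> * r\<^sup>2" .
  \<comment> \<open>The bound must be fixed before the data and the candidate, so it is selected by
    a property of \<open>vstar\<close> and \<open>s\<close> alone. The default 1 takes effect only
    if no such bound exists, and then, as shown below, no data and candidate satisfy the
    hypotheses.\<close>
  define good where "good c \<longleftrightarrow> c > 0 \<and> (\<forall>z. norm z = s \<longrightarrow> ennreal c \<le> vstar z)" for c :: real
  define c where "c = (if Ex good then Eps good else 1)"
  have goodc: "good c" if "Ex good" unfolding c_def using someI_ex[OF that] that by simp
  have c0: "c > 0" using goodc unfolding c_def good_def by (cases "Ex good") simp_all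
  \<comment> \<open>Inside this radius \<open>x\<close> lies within the small sphere and
    \<open>\<beta> * (norm x)\<^sup>2 < c\<close>.\<close>
  define \<rho> where "\<rho> = min s (sqrt (c / \<beta>))"
  have \<rho>0: "\<rho> > 0" unfolding \<rho>_def using s(1) c0 assms(7) by simp
  show ?thesis
  proof (intro exI[of _ "ball 0 \<rho>"] conjI allI impI ballI)
    show "open (ball (0::real^'n) \<rho>)" by (rule open_ball)
    show "0 \<in> ball (0::real^'n) \<rho>" using \<rho>0 by simp
    have "ball (0::real^'n) \<rho> \<subseteq> cball 0 r" using s(2) unfolding \<rho>_def by (intro ball_subset_cball[THEN subset_trans]) auto
    then show "ball 0 \<rho> \<subseteq> \<Omega>" using r(2) by (rule subset_trans)
    fix f :: "real^'n \<Rightarrow> real^'n" and g :: "real^'n \<Rightarrow> real^'m^'n" and h :: "real^'n \<Rightarrow> real"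
      and R :: "real^'m^'m" and v :: "real^'n \<Rightarrow> real" and x :: "real^'n"
    assume sa: "standing_assumptions f g h R \<and> value_function f g h R = vstar"
      and v: "C1_on \<Omega> v \<and>
        (\<forall>x\<in>\<Omega>. v x \<ge> 0) \<and> v 0 = 0 \<and>
        (\<forall>x\<in>\<Omega>. (f x + g x *v feedback g R v x) \<bullet> grad v x + h x
                  + (weighted_norm R (feedback g R v x))\<^sup>2 = 0) \<and>
        (\<forall>x\<in>\<Omega>. \<alpha> * (norm x)\<^sup>2 \<le> v x \<and> v x \<le> \<beta> * (norm x)\<^sup>2)"
      and x: "x \<in> ball 0 \<rho>"
    interpret hjb_candidate f g h R \<Omega> v \<alpha> \<beta> r
      by unfold_locales (use sa v r assms(6,7) in simp_all)
    have vs: "value_function f g h R = vstar" using sa by simp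
    obtain c' where c': "c' > 0" "\<forall>z. norm z = s \<longrightarrow> (\<forall>u\<in>Linf_controls. ennreal c' \<le> cost f g h R z u)"
      using cost_bounded_below_on_sphere[OF s s2] by (elim exE conjE)
    \<comment> \<open>The constant \<open>c'\<close> may depend on the candidate; it serves to
      certify that the earlier choice of \<open>c\<close> succeeded.\<close>
    have "good c'"
      unfolding good_def vs[symmetric] value_function_def using c' by (auto intro!: INF_greatest)
    then have "good c" by (intro goodc exI)
    then have sphere: "ennreal c \<le> value_function f g h R z" if "norm z = s" for z
      using that unfolding good_def vs by simp
    have xs: "norm x < s" "norm x < sqrt (c / \<beta>)" using x unfolding \<rho>_def by simp_all
    have "(norm x)\<^sup>2 < (sqrt (c / \<beta>))\<^sup>2" using xs(2) by (rule power_strict_mono) simp_all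
    also have "(sqrt (c / \<beta>))\<^sup>2 = c / \<beta>" using c0 assms(7) by simp
    finally have "\<beta> * (norm x)\<^sup>2 < c" using assms(7) by (simp add: field_simps)
    then show "ennreal (v x) = value_function f g h R x"
      using candidate_eq_value_function[OF s s2 sphere xs(1)] by simp
  qed
qed

end
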